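(* Let a planar shock wave $x_1=0$ in three-dimensional compressible isentropic elastodynamics (constant states $\widehat U^\pm$ as in the context) satisfy the Lax conditions $$M_->\frac{M}{\sqrt{M^2-M_1^2}},\qquad M_1<M<M_*.$$ Then this shock wave is uniformly stable if and only if $$\min_{\bar{\omega}_2^2+\bar{\omega}_3^2=1}\bigg(M\sqrt{1+|\overline{\mathcal F}_1|^2+|\bar\omega_2\overline{\mathcal F}_2+\bar\omega_3\overline{\mathcal F}_3|^2+\big|\overline{\mathcal F}_1\times(\bar\omega_2\overline{\mathcal F}_2+\bar\omega_3\overline{\mathcal F}_3)\big|^2}-\big|\overline{\mathcal F}_1\cdot(\bar\omega_2\overline{\mathcal F}_2+\bar\omega_3\overline{\mathcal F}_3)\big|\sqrt{1+|\overline{\mathcal F}_1|^2-M^2}\,\bigg)^2-\big(1+|\overline{\mathcal F}_1|^2\big)^2\big(R(M^2-|\overline{\mathcal F}_1|^2)-1\big)>0 .$$ If this inequality is violated, then the planar shock wave is weakly stable.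
   Context: **Model.** The elastodynamics equations (neo-Hookean material) for density $\rho$, velocity $v\in\mathbb R^3$, deformation gradient $F=(F_{ij})\in\mathbb R^{3\times3}$ with columns $F_j$, and pressure $p=p(\rho)$ smooth, are $\partial_t\rho+\mathrm{div}(\rho v)=0$, $\partial_t(\rho v)+\mathrm{div}(\rho v\otimes v)+\nabla p-\mathrm{div}(\rho FF^\top)=0$, $\partial_t(\rho F_j)+\mathrm{div}(\rho F_j\otimes v-v\otimes\rho F_j)=0$ ($j=1,2,3$), with the constraints $\mathrm{div}(\rho F_j)=0$ and $\rho\det F=1$. The sound speed $c>0$ is given by $c^2=p'(\rho)$; hyperbolicity means $\rho>0$, $p'(\rho)>0$. **Planar shock.** Constant states $\widehat U^\pm=(\hat p^\pm,\hat v^\pm,\widehat F_1^\pm,\widehat F_2^\pm,\widehat F_3^\pm)$ on $\{\pm x_1>0\}$ with $\hat\rho^\pm>0$, $\hat p^\pm=p(\hat\rho^\pm)$, $\hat c^\pm=\sqrt{p'(\hat\rho^\pm)}>0$, $\hat\rho^\pm\det\widehat F^\pm=1$, $[\hat\rho]\ne0$, $\hat v_2^\pm=\hat v_3^\pm=0$, $\hat v_1^\pm>0$, and (with $[g]=g^+-g^-$) $\hat\rho^+/\hat\rho^-=\hat v_1^-/\hat v_1^+$, $\ \frac{\hat\rho^+}{\hat\rho^-}\{(\hat v_1^+)^2-\sum_{j=1}^3(\widehat F_{1j}^+)^2\}[\hat\rho]=[\hat p]$, $\ [\widehat F_{lj}]=0$ ($l=2,3$), $\ [\hat\rho\widehat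 F_{1j}]=0$ ($j=1,2,3$). **Notation.** $R=\hat\rho^+/\hat\rho^-$, $M_-=\hat v_1^-/\hat c^-$, $M=\hat v_1^+/\hat c^+$, $\mathcal F_{ij}=\widehat F_{ij}^+/\hat c^+$, rows $\overline{\mathcal F}_j=(\mathcal F_{j1},\mathcal F_{j2},\mathcal F_{j3})^\top$, $M_1=|\overline{\mathcal F}_1|$, $M_*=\sqrt{1+M_1^2}$, $\beta=\sqrt{M_*^2-M^2}$, $\ell_k=\overline{\mathcal F}_1\cdot\overline{\mathcal F}_k$ ($k=2,3$), $d_0=\frac{M_*^2+M^2}{2M^2}$, $a_0=-\frac{\beta^2R}{2M^2}$, $\partial_\star=\partial_t-\frac1{M^2}(\ell_2\partial_2+\ell_3\partial_3)$. **Linearized problem.** For the dimensionless perturbation $U=(p,v^\top,F_1^\top,F_2^\top,F_3^\top)^\top\in\mathbb R^{13}$ behind the shock: $\mathcal A_0\partial_tU+\sum_{j=1}^3\mathcal A_j\partial_jU=0$ for $x_1>0$, where $\mathcal A_0=\mathrm{diag}(1,M^2I_3,I_9)$ and $$\mathcal A_j=\delta_{1j}\mathcal A_0+\begin{pmatrix}0&e_j^\top&0&0&0\\ e_j&0&-\mathcal F_{j1}I_3&-\mathcal F_{j2}I_3&-\mathcal F_{j3}I_3\\0&-\mathcal F_{j1}I_3&0&0&0\\0&-\mathcal F_{j2}I_3&0&0&0\\0&-\mathcal F_{j3}I_3&0&0&0\end{pmatrix},$$ $e_j$ being the standard basis of $\mathbb R^3$, with the 12 boundary conditions on $x_1=0$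 (the front perturbation having been eliminated): $v_1+d_0p-\frac1{M^2R}(\ell_2v_2+\ell_3v_3)=0$; $\partial_\star v_k=a_0\partial_kp$; $F_{1j}+\mathcal F_{1j}p-\frac1R(\mathcal F_{2j}v_2+\mathcal F_{3j}v_3)=0$; $F_{kj}-\mathcal F_{1j}v_k=0$ ($j=1,2,3$, $k=2,3$). **Kreiss–Lopatinski conditions.** Let $s=\eta+i\xi$, $\omega'=(\omega_2,\omega_3)\in\mathbb R^2$. For $\eta>0$ let $\lambda^+(\eta,\xi,\omega')$ be the single root $\lambda$ with $\mathrm{Re}\,\lambda>0$ of $\det(s\mathcal A_0+\lambda\mathcal A_1+i\omega_2\mathcal A_2+i\omega_3\mathcal A_3)=0$, and put $\lambda^+(0,\xi,\omega')=\lim_{\eta\to+0}\lambda^+(\eta,\xi,\omega')$. Let $\widetilde U_0=(\tilde u_1,\dots,\tilde u_{13})^\top$ be the solution (determined up to a nonzero factor) of the Fourier–Laplace transformed boundary conditions (replace $\partial_t\to s$, $\partial_k\to i\omega_k$). With $m=\omega_2\ell_2+\omega_3\ell_3$ it is: $\tilde u_1=s-\frac{im}{M^2}$, $\tilde u_2=-d_0s+\frac{im}{M^2}$, $(\tilde u_3,\tilde u_4)=ia_0\omega'$, $(\tilde u_5,\tilde u_8,\tilde u_{11})^\top=-(s-\frac{im}{M^2})\overline{\mathcal F}_1+\frac{ia_0}{R}(\omega_2\overline{\mathcal F}_2+\omega_3\overline{\mathcal F}_3)$, $(\tilde u_6,\tilde u_9,\tilde u_{12})^\top=ia_0\omega_2\overline{\mathcal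 F}_1$, $(\tilde u_7,\tilde u_{10},\tilde u_{13})^\top=ia_0\omega_3\overline{\mathcal F}_1$. Let $\mathfrak L$ be the $13\times13$ matrix obtained from $s\mathcal A_0+\lambda^+\mathcal A_1+i\omega_2\mathcal A_2+i\omega_3\mathcal A_3$ by replacing its first row with $(\mathcal A_1\widetilde U_0)^\top$ (no complex conjugation). The KL condition: $\det\mathfrak L\ne0$ for all $\eta>0$, $(\xi,\omega')\in\mathbb R^3$. The UKL condition: $\det\mathfrak L\ne0$ for all $\eta\ge0$, $(\xi,\omega')\in\mathbb R^3$ with $\eta^2+\xi^2+|\omega'|^2\ne0$. The planar shock is *uniformly stable* if the UKL condition holds, *weakly stable* if the KL condition holds but the UKL condition is violated, and *violently unstable* if the KL condition is violated. *)

theory Defs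
  imports "HOL-Analysis.Analysis" "HOL-Analysis.Cross3"
begin

unbundle cross3_syntax

section \<open>Planar shock waves\<close>

record elastic_state =
  density :: real
  pressure :: real
  velocity :: "real^3"
  defgrad :: "real^3^3"

text \<open>\<open>defgrad U $ i $ j\<close> is the entry \<open>F\<^bsub>ij\<^esub>\<close>; thus \<open>defgrad U $ i\<close> is the \<open>i\<close>-th row and
  the column \<open>F\<^sub>j\<close> is \<open>column j (defgrad U)\<close>.\<close>

definition smooth_pressure_law :: "(real \<Rightarrow> real) \<Rightarrow> bool" where
  "smooth_pressure_law p \<longleftrightarrow> (\<forall>n. \<forall>\<rho>>0. (deriv ^^ n) p differentiable (at \<rho>))"

definition admissible_state :: "(real \<Rightarrow> real) \<Rightarrow> elastic_state \<Rightarrow> bool" where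
  "admissible_state p U \<longleftrightarrow>
     density U > 0 \<and> pressure U = p (density U) \<and> deriv p (density U) > 0 \<and>
     density U * det (defgrad U) = 1 \<and>
     velocity U $ 2 = 0 \<and> velocity U $ 3 = 0 \<and> velocity U $ 1 > 0"

text \<open>\<open>Um\<close> and \<open>Up\<close> are the constant states on \<open>x\<^sub>1 < 0\<close> and on \<open>x\<^sub>1 > 0\<close> (behind the shock).\<close>

definition planar_shock :: "(real \<Rightarrow> real) \<Rightarrow> elastic_state \<Rightarrow> elastic_state \<Rightarrow> bool" where
  "planar_shock p Um Up \<longleftrightarrow>
     smooth_pressure_law p \<and> admissible_state p Um \<and> admissible_state p Up \<and>
     density Up - density Um \<noteq> 0 \<and>
     density Up / density Um = velocity Um $ 1 / velocity Up $ 1 \<and>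
     density Up / density Um * ((velocity Up $ 1)\<^sup>2 - (\<Sum>j\<in>UNIV. (defgrad Up $ 1 $ j)\<^sup>2))
        * (density Up - density Um) = pressure Up - pressure Um \<and>
     (\<forall>l\<in>{2, 3}. \<forall>j. defgrad Up $ l $ j - defgrad Um $ l $ j = 0) \<and>
     (\<forall>j. density Up * defgrad Up $ 1 $ j - density Um * defgrad Um $ 1 $ j = 0)"

definition sound_speed :: "(real \<Rightarrow> real) \<Rightarrow> elastic_state \<Rightarrow> real" where
  "sound_speed p U = sqrt (deriv p (density U))"

definition mach :: "(real \<Rightarrow> real) \<Rightarrow> elastic_state \<Rightarrow> real" where
  "mach p U = velocity U $ 1 / sound_speed p U"

definition scaled_defgrad :: "(real \<Rightarrow> real) \<Rightarrow> elastic_state \<Rightarrow> real^3^3" where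
  "scaled_defgrad p U = (\<chi> i j. defgrad U $ i $ j / sound_speed p U)"

definition density_ratio :: "elastic_state \<Rightarrow> elastic_state \<Rightarrow> real" where
  "density_ratio Um Up = density Up / density Um"


section \<open>The linearized problem\<close>

text \<open>Below, \<open>M\<close>, \<open>R\<close> and \<open>F\<close> stand for the downstream Mach number, the density ratio and the
  scaled deformation gradient of the downstream state.\<close>

definition M1 :: "real^3^3 \<Rightarrow> real" where
  "M1 F = norm (F $ 1)"

definition Mstar :: "real^3^3 \<Rightarrow> real" where
  "Mstar F = sqrt (1 + (M1 F)\<^sup>2)"

definition beta :: "real \<Rightarrow> real^3^3 \<Rightarrow> real" where
  "beta M F = sqrt ((Mstar F)\<^sup>2 - M\<^sup>2)"

definition ell :: "real^3^3 \<Rightarrow> 3 \<Rightarrow> real" where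
  "ell F k = F $ 1 \<bullet> F $ k"

definition d0 :: "real \<Rightarrow> real^3^3 \<Rightarrow> real" where
  "d0 M F = ((Mstar F)\<^sup>2 + M\<^sup>2) / (2 * M\<^sup>2)"

definition a0 :: "real \<Rightarrow> real \<Rightarrow> real^3^3 \<Rightarrow> real" where
  "a0 M R F = - ((beta M F)\<^sup>2 * R / (2 * M\<^sup>2))"

text \<open>Names for the 13 components of the unknown: \<open>Pres\<close> is the pressure, \<open>Vel i\<close> is \<open>v\<^sub>i\<close> and \<open>Dgr i j\<close>
  is the perturbation of \<open>F\<^bsub>ij\<^esub>\<close>.  In the ordering \<open>(p, v, F\<^sub>1, F\<^sub>2, F\<^sub>3)\<close>, where \<open>F\<^sub>j\<close> is the
  \<open>j\<close>-th column, \<open>Pres\<close> is component 1, \<open>Vel i\<close> is component \<open>1 + i\<close> and \<open>Dgr i j\<close> is component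
  \<open>1 + 3 j + i\<close>.  Determinants do not depend on the chosen ordering of the index set.\<close>

datatype comp = Pres | Vel "3" | Dgr "3" "3"

lemma UNIV_comp: "(UNIV :: comp set) = insert Pres (range Vel \<union> range (\<lambda>(i, j). Dgr i j))"
proof -
  have "x \<in> insert Pres (range Vel \<union> range (\<lambda>(i, j). Dgr i j))" for x :: comp
    by (cases x) auto
  then show ?thesis by blast
qed

instance comp :: finite
  by standard (simp add: UNIV_comp)

lemma card_comp: "CARD(comp) = 13"
proof -
  have "card (range Vel) = 3"
    by (subst card_image) (auto intro: injI)
  moreover have "card (range (\<lambda>(i, j). Dgr i j)) = 9"
    by (subst card_image) (auto intro!: inj_onI)
  moreover have "card (range Vel \<union> range (\<lambda>(i, j). Dgr i j)) = card (range Vel) + card (range (\<lambda>(i, j). Dgr i j))"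
    by (rule card_Un_disjoint) auto
  ultimately show ?thesis
    unfolding UNIV_comp by (subst card_insert_disjoint) auto
qed

definition A0 :: "real \<Rightarrow> real^comp^comp" where
  "A0 M = (\<chi> a b. if a = b then (case a of Pres \<Rightarrow> 1 | Vel _ \<Rightarrow> M\<^sup>2 | Dgr _ _ \<Rightarrow> 1) else 0)"

definition coupling :: "real^3^3 \<Rightarrow> 3 \<Rightarrow> real^comp^comp" where
  "coupling F j = (\<chi> a b.
     (case (a, b) of
        (Pres, Vel k) \<Rightarrow> (if k = j then 1 else 0)
      | (Vel k, Pres) \<Rightarrow> (if k = j then 1 else 0)
      | (Vel k, Dgr i l) \<Rightarrow> (if k = i then - (F $ j $ l) else 0)
      | (Dgr i l, Vel k) \<Rightarrow> (if k = i then - (F $ j $ l) else 0)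
      | _ \<Rightarrow> 0))"

definition Amat :: "real \<Rightarrow> real^3^3 \<Rightarrow> 3 \<Rightarrow> real^comp^comp" where
  "Amat M F j = (if j = 1 then A0 M else 0) + coupling F j"


section \<open>Kreiss--Lopatinski conditions\<close>

definition cmat :: "real^comp^comp \<Rightarrow> complex^comp^comp" where
  "cmat A = (\<chi> a b. complex_of_real (A $ a $ b))"

definition symbol :: "real \<Rightarrow> real^3^3 \<Rightarrow> complex \<Rightarrow> complex \<Rightarrow> real \<Rightarrow> real \<Rightarrow> complex^comp^comp" where
  "symbol M F s l w2 w3 = (\<chi> a b.
     s * cmat (A0 M) $ a $ b + l * cmat (Amat M F 1) $ a $ b
     + \<i> * w2 * cmat (Amat M F 2) $ a $ b + \<i> * w3 * cmat (Amat M F 3) $ a $ b)"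

definition lambda_interior :: "real \<Rightarrow> real^3^3 \<Rightarrow> real \<Rightarrow> real \<Rightarrow> real \<Rightarrow> real \<Rightarrow> complex" where
  "lambda_interior M F \<eta> \<xi> w2 w3 = (THE l. Re l > 0 \<and> det (symbol M F (Complex \<eta> \<xi>) l w2 w3) = 0)"

text \<open>Only used for \<open>\<eta> \<ge> 0\<close>.\<close>

definition lambda_plus :: "real \<Rightarrow> real^3^3 \<Rightarrow> real \<Rightarrow> real \<Rightarrow> real \<Rightarrow> real \<Rightarrow> complex" where
  "lambda_plus M F \<eta> \<xi> w2 w3 =
     (if \<eta> > 0 then lambda_interior M F \<eta> \<xi> w2 w3
      else Lim (at_right 0) (\<lambda>\<epsilon>. lambda_interior M F \<epsilon> \<xi> w2 w3))"

text \<open>The Fourier--Laplace transforms of the boundary conditions, with \<open>\<partial>\<^sub>t\<close> and \<open>\<partial>\<^sub>k\<close> replaced by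
  \<open>s\<close> and \<open>i \<omega>\<^sub>k\<close>.\<close>

definition transformed_bc ::
  "real \<Rightarrow> real \<Rightarrow> real^3^3 \<Rightarrow> complex \<Rightarrow> real \<Rightarrow> real \<Rightarrow> complex^comp \<Rightarrow> bool" where
  "transformed_bc M R F s w2 w3 u \<longleftrightarrow>
     (let ds = s - (ell F 2 * (\<i> * w2) + ell F 3 * (\<i> * w3)) / M\<^sup>2 in
      u $ Vel 1 + d0 M F * u $ Pres - (ell F 2 * u $ Vel 2 + ell F 3 * u $ Vel 3) / (M\<^sup>2 * R) = 0 \<and>
      ds * u $ Vel 2 = a0 M R F * (\<i> * w2) * u $ Pres \<and>
      ds * u $ Vel 3 = a0 M R F * (\<i> * w3) * u $ Pres \<and>
      (\<forall>j. u $ Dgr 1 j + F $ 1 $ j * u $ Pres - (F $ 2 $ j * u $ Vel 2 + F $ 3 $ j * u $ Vel 3) / R = 0) \<and>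
      (\<forall>k\<in>{2, 3}. \<forall>j. u $ Dgr k j - F $ 1 $ j * u $ Vel k = 0))"

definition U0 :: "real \<Rightarrow> real \<Rightarrow> real^3^3 \<Rightarrow> complex \<Rightarrow> real \<Rightarrow> real \<Rightarrow> complex^comp" where
  "U0 M R F (s :: complex) w2 w3 =
     (let m = w2 * ell F 2 + w3 * ell F 3;
          w = (\<lambda>k :: 3. if k = 2 then w2 else w3)
      in \<chi> c. case c of
          Pres \<Rightarrow> s - \<i> * m / M\<^sup>2
        | Vel k \<Rightarrow> if k = 1 then - (complex_of_real (d0 M F) * s) + \<i> * m / M\<^sup>2 else \<i> * a0 M R F * w k
        | Dgr k j \<Rightarrow> if k = 1
            then - (s - \<i> * m / M\<^sup>2) * F $ 1 $ j
                 + \<i> * a0 M R F / R * (w2 * F $ 2 $ j + w3 * F $ 3 $ j)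
            else \<i> * a0 M R F * w k * F $ 1 $ j)"

lemma d0_a0: 
  assumes "M > 0" "R \<noteq> 0" "M < Mstar F"
  shows "d0 M F + a0 M R F / R = 1"
proof -
  have "M\<^sup>2 < (Mstar F)\<^sup>2" using assms by (intro power_strict_mono) auto
  then have "(beta M F)\<^sup>2 = (Mstar F)\<^sup>2 - M\<^sup>2" by (simp add: beta_def)
  moreover have "d0 M F + a0 M R F / R = ((Mstar F)\<^sup>2 + M\<^sup>2 - (beta M F)\<^sup>2) / (2 * M\<^sup>2)"
    using assms by (simp add: d0_def a0_def add_divide_distrib diff_divide_distrib)
  ultimately show ?thesis using assms by simp
qed

lemma forall_3_split: "(\<forall>k\<in>{2, 3 :: 3}. Q k) \<longleftrightarrow> Q 2 \<and> Q 3" by auto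

lemma transformed_bc_U0:
  assumes "M > 0" "R \<noteq> 0" "M < Mstar F"
  shows "transformed_bc M R F s w2 w3 (U0 M R F s w2 w3)"
proof -
  have a0: "complex_of_real (d0 M F) = 1 - complex_of_real (a0 M R F) / R"
    using d0_a0[OF assms] by (metis of_real_1 of_real_add of_real_divide add_diff_cancel_right')
  show ?thesis
    unfolding transformed_bc_def U0_def Let_def forall_3_split
    using assms by (simp add: a0 field_simps power2_eq_square)
qed

text \<open>Uniqueness up to a factor fails when \<open>s = i m / M\<^sup>2\<close>, where the two conditions for \<open>v\<^sub>2\<close> and
  \<open>v\<^sub>3\<close> degenerate; the formula for \<open>U0\<close> is used for all \<open>s\<close>.\<close>

lemma transformed_bc_unique:
  assumes "M > 0" "R \<noteq> 0" "M < Mstar F" and "Re s > 0"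
    and "transformed_bc M R F s w2 w3 u"
  shows "\<exists>k. \<forall>c. u $ c = k * U0 M R F s w2 w3 $ c"
proof -
  define m where "m = w2 * ell F 2 + w3 * ell F 3"
  define d where "d = s - \<i> * m / (complex_of_real M)\<^sup>2"
  have "Re (\<i> * complex_of_real m / (complex_of_real M)\<^sup>2) = 0"
    by (simp flip: of_real_power)
  then have "Re d = Re s" unfolding d_def by simp
  with assms have d: "d \<noteq> 0" by auto
  define k where "k = u $ Pres / d"
  have uP: "u $ Pres = k * d" using d by (simp add: k_def)
  have dd: "s - (ell F 2 * (\<i> * w2) + ell F 3 * (\<i> * w3)) / (complex_of_real M)\<^sup>2 = d"
    unfolding d_def m_def by (simp add: algebra_simps add_divide_distrib)
  have bc: "u $ Vel 1 + d0 M F * u $ Pres - (ell F 2 * u $ Vel 2 + ell F 3 * u $ Vel 3) / ((complex_of_real M)\<^sup>2 * R) = 0"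
    "d * u $ Vel 2 = a0 M R F * (\<i> * w2) * u $ Pres"
    "d * u $ Vel 3 = a0 M R F * (\<i> * w3) * u $ Pres"
    "\<And>j. u $ Dgr 1 j + F $ 1 $ j * u $ Pres - (F $ 2 $ j * u $ Vel 2 + F $ 3 $ j * u $ Vel 3) / R = 0"
    "\<And>j. u $ Dgr 2 j - F $ 1 $ j * u $ Vel 2 = 0" "\<And>j. u $ Dgr 3 j - F $ 1 $ j * u $ Vel 3 = 0"
    using assms(5) unfolding transformed_bc_def Let_def dd forall_3_split by auto
  let ?U = "U0 M R F s w2 w3"
  have bcU: "?U $ Vel 1 + d0 M F * ?U $ Pres - (ell F 2 * ?U $ Vel 2 + ell F 3 * ?U $ Vel 3) / ((complex_of_real M)\<^sup>2 * R) = 0"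
    "\<And>j. ?U $ Dgr 1 j + F $ 1 $ j * ?U $ Pres - (F $ 2 $ j * ?U $ Vel 2 + F $ 3 $ j * ?U $ Vel 3) / R = 0"
    "\<And>j. ?U $ Dgr 2 j - F $ 1 $ j * ?U $ Vel 2 = 0" "\<And>j. ?U $ Dgr 3 j - F $ 1 $ j * ?U $ Vel 3 = 0"
    using transformed_bc_U0[OF assms(1-3), of s w2 w3] 
    unfolding transformed_bc_def Let_def forall_3_split by auto
  have UP: "?U $ Pres = d" by (simp add: U0_def d_def m_def Let_def)
  have U2: "?U $ Vel 2 = \<i> * a0 M R F * w2" "?U $ Vel 3 = \<i> * a0 M R F * w3"
    by (simp_all add: U0_def Let_def)
  have u2: "u $ Vel 2 = k * ?U $ Vel 2" using bc(2) d unfolding uP U2 by (simp add: algebra_simps)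
  have u3: "u $ Vel 3 = k * ?U $ Vel 3" using bc(3) d unfolding uP U2 by (simp add: algebra_simps)
  have UV1: "?U $ Vel 1 = (ell F 2 * ?U $ Vel 2 + ell F 3 * ?U $ Vel 3) / ((complex_of_real M)\<^sup>2 * R) - d0 M F * d"
    using bcU(1) unfolding UP by algebra
  have uV1: "u $ Vel 1 = (ell F 2 * u $ Vel 2 + ell F 3 * u $ Vel 3) / ((complex_of_real M)\<^sup>2 * R) - d0 M F * u $ Pres"
    using bc(1) by algebra
  have u1: "u $ Vel 1 = k * ?U $ Vel 1"
    unfolding UV1 uV1 u2 u3 uP by (simp add: algebra_simps add_divide_distrib)
  have UG1: "?U $ Dgr 1 j = (F $ 2 $ j * ?U $ Vel 2 + F $ 3 $ j * ?U $ Vel 3) / R - F $ 1 $ j * d" for j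
    using bcU(2)[of j] unfolding UP by algebra
  have uG1: "u $ Dgr 1 j = (F $ 2 $ j * u $ Vel 2 + F $ 3 $ j * u $ Vel 3) / R - F $ 1 $ j * u $ Pres" for j
    using bc(4)[of j] by algebra
  have g1: "u $ Dgr 1 j = k * ?U $ Dgr 1 j" for j
    unfolding UG1 uG1 u2 u3 uP by (simp add: algebra_simps add_divide_distrib)
  have g2: "u $ Dgr 2 j = k * ?U $ Dgr 2 j" "u $ Dgr 3 j = k * ?U $ Dgr 3 j" for j
    using bc(5,6)[of j] bcU(3,4)[of j] u2 u3 by (simp_all add: algebra_simps)
  have "u $ c = k * ?U $ c" for c
  proof (cases c)
    case Pres
    then show ?thesis using uP UP by simp
  next
    case (Vel i)
    then show ?thesis using u1 u2 u3 exhaust_3[of i] by auto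
  next
    case (Dgr i j)
    then show ?thesis using g1 g2 exhaust_3[of i] by auto
  qed
  then show ?thesis by blast
qed

definition lopatinski_matrix ::
  "real \<Rightarrow> real \<Rightarrow> real^3^3 \<Rightarrow> real \<Rightarrow> real \<Rightarrow> real \<Rightarrow> real \<Rightarrow> complex^comp^comp" where
  "lopatinski_matrix M R F \<eta> \<xi> w2 w3 =
     (let s = Complex \<eta> \<xi> in
      \<chi> a. if a = Pres then cmat (Amat M F 1) *v U0 M R F s w2 w3
            else symbol M F s (lambda_plus M F \<eta> \<xi> w2 w3) w2 w3 $ a)"

definition KL_condition :: "real \<Rightarrow> real \<Rightarrow> real^3^3 \<Rightarrow> bool" where
  "KL_condition M R F \<longleftrightarrow>
     (\<forall>\<eta> \<xi> w2 w3. \<eta> > 0 \<longrightarrow> det (lopatinski_matrix M R F \<eta> \<xi> w2 w3) \<noteq> 0)"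

definition UKL_condition :: "real \<Rightarrow> real \<Rightarrow> real^3^3 \<Rightarrow> bool" where
  "UKL_condition M R F \<longleftrightarrow>
     (\<forall>\<eta> \<xi> w2 w3. \<eta> \<ge> 0 \<and> \<eta>\<^sup>2 + \<xi>\<^sup>2 + (w2\<^sup>2 + w3\<^sup>2) \<noteq> 0
        \<longrightarrow> det (lopatinski_matrix M R F \<eta> \<xi> w2 w3) \<noteq> 0)"

definition uniformly_stable :: "(real \<Rightarrow> real) \<Rightarrow> elastic_state \<Rightarrow> elastic_state \<Rightarrow> bool" where
  "uniformly_stable p Um Up \<longleftrightarrow>
     UKL_condition (mach p Up) (density_ratio Um Up) (scaled_defgrad p Up)"

definition weakly_stable :: "(real \<Rightarrow> real) \<Rightarrow> elastic_state \<Rightarrow> elastic_state \<Rightarrow> bool" where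
  "weakly_stable p Um Up \<longleftrightarrow>
     KL_condition (mach p Up) (density_ratio Um Up) (scaled_defgrad p Up) \<and>
     \<not> UKL_condition (mach p Up) (density_ratio Um Up) (scaled_defgrad p Up)"


section \<open>The stability criterion\<close>

definition criterion_term :: "real \<Rightarrow> real^3^3 \<Rightarrow> real \<times> real \<Rightarrow> real" where
  "criterion_term M F = (\<lambda>(w2, w3).
     let W = w2 *\<^sub>R F $ 2 + w3 *\<^sub>R F $ 3 in
     (M * sqrt (1 + (norm (F $ 1))\<^sup>2 + (norm W)\<^sup>2 + (norm (F $ 1 \<times> W))\<^sup>2)
        - \<bar>F $ 1 \<bullet> W\<bar> * sqrt (1 + (norm (F $ 1))\<^sup>2 - M\<^sup>2))\<^sup>2)"

definition stability_margin :: "real \<Rightarrow> real \<Rightarrow> real^3^3 \<Rightarrow> real" where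
  "stability_margin M R F =
     (INF w\<in>{(w2, w3). w2\<^sup>2 + w3\<^sup>2 = 1}. criterion_term M F w)
     - (1 + (norm (F $ 1))\<^sup>2)\<^sup>2 * (R * (M\<^sup>2 - (norm (F $ 1))\<^sup>2) - 1)"

text \<open>The infimum is a minimum.\<close>

lemma criterion_term_min_attained:
  obtains w0 where "w0 \<in> {(w2, w3). w2\<^sup>2 + w3\<^sup>2 = 1}"
    and "(INF w\<in>{(w2, w3). w2\<^sup>2 + w3\<^sup>2 = 1}. criterion_term M F w) = criterion_term M F w0"
proof -
  let ?S = "{(w2, w3). w2\<^sup>2 + w3\<^sup>2 = 1} :: (real \<times> real) set"
  have S: "?S = sphere 0 1"
    by (auto simp: norm_Pair real_sqrt_eq_1_iff)
  have "continuous_on ?S (criterion_term M F)"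
    unfolding criterion_term_def case_prod_beta Let_def
    by (intro continuous_intros continuous_on_cross)
  moreover have "compact ?S" unfolding S by simp
  moreover have "(1, 0) \<in> ?S" by simp
  ultimately obtain w0 where w0: "w0 \<in> ?S" "\<And>w. w \<in> ?S \<Longrightarrow> criterion_term M F w0 \<le> criterion_term M F w"
    using continuous_attains_inf[of ?S "criterion_term M F"] by blast
  then have "(INF w\<in>?S. criterion_term M F w) = criterion_term M F w0"
    by (intro cInf_eq_minimum) auto
  with w0(1) show ?thesis by (rule that)
qed

end

theory Submission
  imports Defs
begin

text \<open>
  Write \<open>F\<^sub>1\<close> for the first row of the scaled deformation gradient, \<open>W = \<omega>\<^sub>2 F\<^sub>2 + \<omega>\<^sub>3 F\<^sub>3\<close>,
  \<open>m = F\<^sub>1 \<bullet> W\<close>, \<open>M\<^sub>*\<^sup>2 = 1 + M\<^sub>1\<^sup>2\<close> and \<open>\<beta>\<^sup>2 = M\<^sub>*\<^sup>2 - M\<^sup>2\<close>.  Away from \<open>s + \<lambda> = 0\<close> and from the shear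
  waves, all rows of the symbol but the first have a one-dimensional common kernel, spanned by an
  explicit vector, so a determinant whose first row is \<open>r\<close> vanishes iff \<open>r\<close> annihilates that vector.
  For the symbol itself this gives the quadratic dispersion relation
  \<open>\<beta>\<^sup>2 \<lambda>\<^sup>2 - 2 (M\<^sup>2 s - i m) \<lambda> - (M\<^sup>2 s\<^sup>2 + |W|\<^sup>2 + |\<omega>|\<^sup>2) = 0\<close>; an energy estimate, based on \<open>M\<^sub>1 < M\<close>,
  excludes shear waves with \<open>Re \<lambda> > 0\<close>.  For the Lopatinski matrix the pairing factors, modulo the
  dispersion relation, as a nonvanishing multiple of \<open>\<beta>\<^sup>2 \<lambda>\<^sup>2 + K |\<omega>|\<^sup>2\<close> with
  \<open>K = R (M\<^sup>2 - M\<^sub>1\<^sup>2) - 1 > -1\<close>.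

  If \<open>K < 0\<close>, a zero would have a positive real \<open>\<lambda> < |\<omega>| / \<beta>\<close>, contradicting the dispersion relation.
  If \<open>K \<ge> 0\<close>, a zero has \<open>\<lambda>\<close> on the imaginary axis, hence \<open>Re s = 0\<close>, and the Kreiss-Lopatinski
  condition always holds.  On the boundary \<open>s = i \<xi>\<close> the imaginary values of \<open>\<beta>\<^sup>2 \<lambda>\<close> are
  \<open>i (M \<alpha> / M\<^sub>* - \<beta>\<^sup>2 m / M\<^sub>*\<^sup>2 \<plusminus> sqrt (\<alpha>\<^sup>2 - P\<^sup>2))\<close>, where \<open>\<alpha>\<close> is a shifted and rescaled \<open>\<xi>\<close>, \<open>\<bar>\<alpha>\<bar> \<ge> P\<close>,
  and the sign is that of \<open>\<alpha>\<close>.  By monotonicity in \<open>\<alpha>\<close> the values \<open>\<plusminus> i \<beta> |\<omega>| sqrt K\<close> are attained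
  iff the criterion fails.
\<close>

section \<open>The kernel of the symbol\<close>

lemma sum_UNIV_comp:
  fixes f :: "comp \<Rightarrow> 'a::comm_monoid_add"
  shows "(\<Sum>c\<in>UNIV. f c) = f Pres + ((\<Sum>i\<in>UNIV. f (Vel i)) + (\<Sum>i\<in>UNIV. \<Sum>j\<in>UNIV. f (Dgr i j)))"
proof -
  have inj: "inj Vel" "inj (\<lambda>(i, j). Dgr i j)"
    by (auto intro!: injI)
  have "(\<Sum>c\<in>UNIV. f c) = f Pres + (\<Sum>c\<in>range Vel \<union> range (\<lambda>(i, j). Dgr i j). f c)"
    unfolding UNIV_comp by (subst sum.insert) auto
  also have "(\<Sum>c\<in>range Vel \<union> range (\<lambda>(i, j). Dgr i j). f c)
      = (\<Sum>c\<in>range Vel. f c) + (\<Sum>c\<in>range (\<lambda>(i, j). Dgr i j). f c)"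
    by (intro sum.union_disjoint) auto
  also have "(\<Sum>c\<in>range (\<lambda>(i, j). Dgr i j). f c) = (\<Sum>x\<in>Sigma UNIV (\<lambda>_. UNIV). f (Dgr (fst x) (snd x)))"
    using sum.reindex[OF inj(2), of f] by (simp add: case_prod_beta o_def)
  also have "\<dots> = (\<Sum>i\<in>UNIV. \<Sum>j\<in>UNIV. f (Dgr i j))"
    by (simp add: sum.cartesian_product case_prod_beta)
  finally show ?thesis
    using inj(1) by (simp add: sum.reindex)
qed

lemma det_eq_0_iff_nontrivial_kernel:
  fixes A :: "'a::field^'n^'n"
  shows "det A = 0 \<longleftrightarrow> (\<exists>x. x \<noteq> 0 \<and> A *v x = 0)"
  using invertible_det_nz[of A] invertible_left_inverse[of A] matrix_left_invertible_ker[of A]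
  by blast

definition tang :: "real^3^3 \<Rightarrow> real \<Rightarrow> real \<Rightarrow> real^3" where
  "tang F w2 w3 = w2 *\<^sub>R F $ 2 + w3 *\<^sub>R F $ 3"

text \<open>The transformed gradient, with the normal derivative replaced by
  \<open>l\<close>.\<close>

definition wavevec :: "complex \<Rightarrow> real \<Rightarrow> real \<Rightarrow> complex^3" where
  "wavevec l w2 w3 = vector [l, \<i> * w2, \<i> * w3]"

text \<open>With k = \<open>wavevec l w2 w3\<close>, entry j is the sum over i of k_i F_ij: the
  transform of differentiation along the j-th column of \<open>F\<close>.\<close>

definition strain :: "real^3^3 \<Rightarrow> complex \<Rightarrow> real \<Rightarrow> real \<Rightarrow> complex^3" where
  "strain F l w2 w3 = (\<chi> j. l * F $ 1 $ j + \<i> * tang F w2 w3 $ j)"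

definition shear :: "real \<Rightarrow> real^3^3 \<Rightarrow> complex \<Rightarrow> complex \<Rightarrow> real \<Rightarrow> real \<Rightarrow> complex" where
  "shear M F s l w2 w3 = (M * (s + l))\<^sup>2 - (\<Sum>j\<in>UNIV. (strain F l w2 w3 $ j)\<^sup>2)"

text \<open>Found by solving the \<open>Dgr\<close> rows for the deformation and then the
  \<open>Vel\<close> rows for the velocity, scaled so that all denominators disappear.\<close>

definition mode :: "real \<Rightarrow> real^3^3 \<Rightarrow> complex \<Rightarrow> complex \<Rightarrow> real \<Rightarrow> real \<Rightarrow> complex^comp" where
  "mode M F s l w2 w3 = (\<chi> c. case c of
      Pres \<Rightarrow> shear M F s l w2 w3
    | Vel i \<Rightarrow> - ((s + l) * wavevec l w2 w3 $ i)
    | Dgr i j \<Rightarrow> - (strain F l w2 w3 $ j * wavevec l w2 w3 $ i))"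

lemma wavevec_nth [simp]:
  "wavevec l w2 w3 $ 1 = l" "wavevec l w2 w3 $ 2 = \<i> * w2" "wavevec l w2 w3 $ 3 = \<i> * w3"
  by (simp_all add: wavevec_def)

lemma cmat_Amat_1_mult:
  "(cmat (Amat M F 1) *v u) $ Pres = u $ Pres + u $ Vel 1"
  "(cmat (Amat M F 1) *v u) $ Vel i
     = M\<^sup>2 * u $ Vel i + (if i = 1 then u $ Pres else 0) - (\<Sum>j\<in>UNIV. F $ 1 $ j * u $ Dgr i j)"
  "(cmat (Amat M F 1) *v u) $ Dgr i j = u $ Dgr i j - F $ 1 $ j * u $ Vel i"
  using exhaust_3[of i] exhaust_3[of j]
  by (auto simp: matrix_vector_mult_def sum_UNIV_comp cmat_def Amat_def A0_def coupling_def sum_3)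

lemma symbol_mult:
  "(symbol M F s l w2 w3 *v u) $ Pres = (s + l) * u $ Pres + (\<Sum>i\<in>UNIV. wavevec l w2 w3 $ i * u $ Vel i)"
  "(symbol M F s l w2 w3 *v u) $ Vel i
     = M\<^sup>2 * (s + l) * u $ Vel i + wavevec l w2 w3 $ i * u $ Pres
       - (\<Sum>j\<in>UNIV. strain F l w2 w3 $ j * u $ Dgr i j)"
  "(symbol M F s l w2 w3 *v u) $ Dgr i j = (s + l) * u $ Dgr i j - strain F l w2 w3 $ j * u $ Vel i"
  using exhaust_3[of i] exhaust_3[of j]
  by (auto simp: matrix_vector_mult_def sum_UNIV_comp cmat_def symbol_def Amat_def A0_def coupling_def
      sum_3 strain_def tang_def algebra_simps)

text \<open>As s + l is nonzero, the \<open>Dgr\<close> rows express the deformation through v;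
  inserting this turns each \<open>Vel\<close> row into shear * v_i = - (s + l) k_i p. So p alone
  fixes a common null vector of these rows, and only the first row is left as a condition.\<close>

lemma det_replace_first_row:
  fixes r :: "complex^comp"
  assumes "s + l \<noteq> 0" and "shear M F s l w2 w3 \<noteq> 0"
  shows "det (\<chi> a. if a = Pres then r else symbol M F s l w2 w3 $ a) = 0
    \<longleftrightarrow> (\<Sum>c\<in>UNIV. r $ c * mode M F s l w2 w3 $ c) = 0"
proof -
  define B where "B = (\<chi> a. if a = Pres then r else symbol M F s l w2 w3 $ a)"
  define N where "N = shear M F s l w2 w3"
  define \<sigma> where "\<sigma> = s + l"
  define q where "q = strain F l w2 w3"
  define k where "k = wavevec l w2 w3"
  define w where "w = mode M F s l w2 w3"
  have N: "N = M\<^sup>2 * \<sigma>\<^sup>2 - (\<Sum>j\<in>UNIV. (q $ j)\<^sup>2)"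
    by (simp add: N_def shear_def \<sigma>_def q_def power_mult_distrib)
  have w: "w $ Pres = N" "\<And>i. w $ Vel i = - (\<sigma> * k $ i)" "\<And>i j. w $ Dgr i j = - (q $ j * k $ i)"
    by (simp_all add: w_def mode_def N_def \<sigma>_def k_def q_def)
  have nz: "\<sigma> \<noteq> 0" "N \<noteq> 0" using assms by (simp_all add: \<sigma>_def N_def)
  have BP: "(B *v u) $ Pres = (\<Sum>c\<in>UNIV. r $ c * u $ c)" for u
    by (simp add: B_def matrix_vector_mult_def)
  have Bother: "(B *v u) $ a = (symbol M F s l w2 w3 *v u) $ a" if "a \<noteq> Pres" for u a
    using that by (simp add: B_def matrix_vector_mult_def)
  have BV: "(B *v u) $ Vel i = M\<^sup>2 * \<sigma> * u $ Vel i + k $ i * u $ Pres - (\<Sum>j\<in>UNIV. q $ j * u $ Dgr i j)"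
    and BD: "(B *v u) $ Dgr i j = \<sigma> * u $ Dgr i j - q $ j * u $ Vel i" for u i j
    by (simp_all add: Bother symbol_mult \<sigma>_def k_def q_def)
  have ker: "u = (u $ Pres / N) *s w" if "B *v u = 0" for u
  proof -
    have D: "u $ Dgr i j = q $ j * u $ Vel i / \<sigma>" for i j
      using BD[of u i j] that nz by (simp add: field_simps)
    have V: "u $ Vel i = - (\<sigma> * k $ i) * u $ Pres / N" for i
    proof -
      define Q where "Q = (\<Sum>j\<in>UNIV. (q $ j)\<^sup>2)"
      have "(\<Sum>j\<in>UNIV. q $ j * u $ Dgr i j) = Q * u $ Vel i / \<sigma>"
        by (simp add: D Q_def sum_3 power2_eq_square add_divide_distrib distrib_right mult.assoc)
      then have "M\<^sup>2 * \<sigma> * u $ Vel i + k $ i * u $ Pres = Q * u $ Vel i / \<sigma>"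
        using BV[of u i] that by simp
      then have "\<sigma> * (M\<^sup>2 * \<sigma> * u $ Vel i + k $ i * u $ Pres) = Q * u $ Vel i"
        using nz by (simp add: field_simps)
      moreover have "N * u $ Vel i = \<sigma> * (M\<^sup>2 * \<sigma> * u $ Vel i + k $ i * u $ Pres) - \<sigma> * k $ i * u $ Pres - Q * u $ Vel i"
        unfolding N Q_def[symmetric] power2_eq_square[of \<sigma>] by (simp add: algebra_simps)
      ultimately have "N * u $ Vel i = - (\<sigma> * k $ i) * u $ Pres"
        by simp
      then show ?thesis using nz(2) by (metis nonzero_mult_div_cancel_left)
    qed
    have "u $ c = (u $ Pres / N) * w $ c" for c
      using nz by (cases c) (simp_all add: w D V)
    then show ?thesis unfolding vec_eq_iff vector_smult_component by blast
  qed
  have Bw: "B *v w = (\<chi> a. if a = Pres then \<Sum>c\<in>UNIV. r $ c * w $ c else 0)"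
  proof -
    have "(B *v w) $ a = (if a = Pres then \<Sum>c\<in>UNIV. r $ c * w $ c else 0)" for a
    proof (cases a)
      case (Vel i)
      then show ?thesis by (simp add: BV w N sum_3 algebra_simps power2_eq_square)
    next
      case (Dgr i j)
      then show ?thesis by (simp add: BD w)
    qed (simp add: BP)
    then show ?thesis by (simp add: vec_eq_iff)
  qed
  have "w \<noteq> 0" using w(1) nz by auto
  have "(\<exists>x. x \<noteq> 0 \<and> B *v x = 0) \<longleftrightarrow> (\<Sum>c\<in>UNIV. r $ c * w $ c) = 0"
  proof
    assume "\<exists>x. x \<noteq> 0 \<and> B *v x = 0"
    then obtain x where x: "x \<noteq> 0" "B *v x = 0" by blast
    define t where "t = x $ Pres / N"
    have xt: "x = t *s w" using ker[OF x(2)] by (simp add: t_def)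
    then have "t \<noteq> 0" using x(1) by auto
    moreover have "(\<Sum>c\<in>UNIV. r $ c * x $ c) = 0" using BP[of x] x(2) by simp
    then have "t * (\<Sum>c\<in>UNIV. r $ c * w $ c) = 0"
      unfolding xt by (simp add: sum_distrib_left mult_ac)
    ultimately show "(\<Sum>c\<in>UNIV. r $ c * w $ c) = 0" by simp
  next
    assume "(\<Sum>c\<in>UNIV. r $ c * w $ c) = 0"
    then have "B *v w = 0" by (simp add: Bw vec_eq_iff)
    then show "\<exists>x. x \<noteq> 0 \<and> B *v x = 0" using \<open>w \<noteq> 0\<close> by blast
  qed
  then show ?thesis
    by (simp add: det_eq_0_iff_nontrivial_kernel flip: B_def w_def)
qed

text \<open>The factor k_i is pulled out of the velocity and deformation parts, so that for
  \<open>U0\<close> only the scalar products of \<open>sum_strain\<close> remain to be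
  evaluated.\<close>

lemma sum_Amat_1_mode:
  "(\<Sum>c\<in>UNIV. (cmat (Amat M F 1) *v u) $ c * mode M F s l w2 w3 $ c)
    = (u $ Pres + u $ Vel 1) * shear M F s l w2 w3
      - (s + l) * (\<Sum>i\<in>UNIV. wavevec l w2 w3 $ i * (complex_of_real (M\<^sup>2) * u $ Vel i + (if i = 1 then u $ Pres else 0)
          - (\<Sum>j\<in>UNIV. F $ 1 $ j * u $ Dgr i j)))
      - (\<Sum>i\<in>UNIV. wavevec l w2 w3 $ i * ((\<Sum>j\<in>UNIV. u $ Dgr i j * strain F l w2 w3 $ j)
          - (\<Sum>j\<in>UNIV. F $ 1 $ j * strain F l w2 w3 $ j) * u $ Vel i))"
proof -
  define q where "q = strain F l w2 w3"
  define k where "k = wavevec l w2 w3"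
  have D: "(\<Sum>j\<in>UNIV. (u $ Dgr i j - F $ 1 $ j * u $ Vel i) * - (q $ j * k $ i))
    = - (k $ i * ((\<Sum>j\<in>UNIV. u $ Dgr i j * q $ j) - (\<Sum>j\<in>UNIV. F $ 1 $ j * q $ j) * u $ Vel i))" for i
    by (simp add: sum_3 algebra_simps)
  have V: "y * - ((s + l) * k $ i) = - ((s + l) * (k $ i * y))" for y i
    by simp
  show ?thesis
    unfolding sum_UNIV_comp cmat_Amat_1_mult mode_def vec_lambda_beta comp.case
      q_def[symmetric] k_def[symmetric] D V sum_negf sum_distrib_left
    by simp
qed

section \<open>A square root of a sum of squares\<close>

text \<open>The origin belongs to the branch cut, but continuity survives there because |csqrt z|^2
  = |z|. This case occurs when a factor of \<open>hsqrt\<close> vanishes.\<close>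

lemma csqrt_continuous_at:
  assumes "z \<notin> \<real>\<^sub>\<le>\<^sub>0 \<or> z = 0"
  shows "isCont csqrt z"
proof (cases "z = 0")
  case True
  have "isCont (\<lambda>z::complex. sqrt (norm z)) 0"
    by (intro continuous_intros)
  then have "((\<lambda>z. norm (csqrt z)) \<longlongrightarrow> 0) (at 0)"
    by (simp add: isCont_def norm_csqrt)
  then have "(csqrt \<longlongrightarrow> 0) (at 0)"
    by (rule tendsto_norm_zero_cancel)
  then show ?thesis by (simp add: isCont_def True)
next
  case False
  then show ?thesis using assms by (simp add: continuous_at_csqrt)
qed

text \<open>The root of \<open>a\<^sup>2 + P\<^sup>2\<close> with positive real part for \<open>Re a > 0\<close>.  Unlike \<open>csqrt (a\<^sup>2 + P\<^sup>2)\<close>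
  it extends continuously to the imaginary axis, since for \<open>Re a = 0\<close> both factors avoid the branch
  cut.\<close>

definition hsqrt :: "complex \<Rightarrow> real \<Rightarrow> complex" where
  "hsqrt a P = csqrt (a + \<i> * P) * csqrt (a - \<i> * P)"

lemma hsqrt_squared: "(hsqrt a P)\<^sup>2 = a\<^sup>2 + P\<^sup>2"
  unfolding hsqrt_def power_mult_distrib power2_csqrt by (simp add: algebra_simps power2_eq_square)

text \<open>Both factors have squares with real part Re a. The claim then rests on (A + x^2)(A +
  y^2) - (A + x y)^2 = A (x - y)^2 with A = Re a and x, y the absolute imaginary parts. This bound
  later separates the two roots of the dispersion relation.\<close>

lemma Re_hsqrt_ge:
  assumes "Re a \<ge> 0"
  shows "Re (hsqrt a P) \<ge> Re a"
proof -
  define u v where "u = csqrt (a + \<i> * P)" and "v = csqrt (a - \<i> * P)"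
  have "Re (u\<^sup>2) = Re a" "Re (v\<^sup>2) = Re a" by (simp_all add: u_def v_def del: Re_power2)
  then have u: "(Re u)\<^sup>2 = Re a + (Im u)\<^sup>2" and v: "(Re v)\<^sup>2 = Re a + (Im v)\<^sup>2" 
    by (simp_all add: Re_power2 algebra_simps)
  have pos: "Re u \<ge> 0" "Re v \<ge> 0" unfolding u_def v_def by (rule Re_csqrt)+
  have "(Re a + \<bar>Im u * Im v\<bar>)\<^sup>2 \<le> (Re u * Re v)\<^sup>2"
  proof -
    have "0 \<le> Re a * (\<bar>Im u\<bar> - \<bar>Im v\<bar>)\<^sup>2" using assms by simp
    also have "\<dots> = (Re u * Re v)\<^sup>2 - (Re a + \<bar>Im u * Im v\<bar>)\<^sup>2"
      unfolding power_mult_distrib u v power2_sum power2_diff abs_mult power2_abs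
      by (simp add: algebra_simps power2_eq_square[of "Re a"])
    finally show ?thesis by simp
  qed
  then have "Re a + \<bar>Im u * Im v\<bar> \<le> Re u * Re v"
    by (rule power2_le_imp_le) (rule mult_nonneg_nonneg[OF pos])
  then have "Re a \<le> Re (u * v)" by simp
  then show ?thesis by (simp only: hsqrt_def u_def v_def)
qed

lemma csqrt_imaginary:
  "x \<ge> 0 \<Longrightarrow> csqrt (\<i> * x) = Complex (sqrt (x/2)) (sqrt (x/2))"
  "x \<le> 0 \<Longrightarrow> csqrt (\<i> * x) = Complex (sqrt (-x/2)) (- sqrt (-x/2))"
  by (auto simp: complex_eq_iff cmod_def sgn_if)

text \<open>The factors are roots of i(\<alpha> + P) and i(\<alpha> - P), each on one of the
  diagonals at angles pi/4 and -pi/4. Equal angles give an imaginary product whose sign is that of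
  \<alpha>; opposite angles give a positive real one.\<close>

lemma hsqrt_imaginary:
  assumes "P \<ge> 0"
  shows "\<alpha> \<ge> P \<Longrightarrow> hsqrt (\<i> * \<alpha>) P = \<i> * sqrt (\<alpha>\<^sup>2 - P\<^sup>2)"
    and "\<alpha> \<le> - P \<Longrightarrow> hsqrt (\<i> * \<alpha>) P = - \<i> * sqrt (\<alpha>\<^sup>2 - P\<^sup>2)"
    and "\<bar>\<alpha>\<bar> < P \<Longrightarrow> Re (hsqrt (\<i> * \<alpha>) P) > 0"
proof -
  have h: "hsqrt (\<i> * \<alpha>) P = csqrt (\<i> * of_real (\<alpha> + P)) * csqrt (\<i> * of_real (\<alpha> - P))"
    by (simp add: hsqrt_def algebra_simps)
  have e: "sqrt (x / 2) * sqrt (y / 2) = sqrt (x * y) / 2" for x y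
    by (simp add: real_sqrt_divide real_sqrt_mult)
  show "\<alpha> \<ge> P \<Longrightarrow> hsqrt (\<i> * \<alpha>) P = \<i> * sqrt (\<alpha>\<^sup>2 - P\<^sup>2)"
    unfolding h using assms
    by (subst (1 2) csqrt_imaginary(1)) (auto simp: complex_eq_iff e algebra_simps power2_eq_square)
  show "\<alpha> \<le> - P \<Longrightarrow> hsqrt (\<i> * \<alpha>) P = - \<i> * sqrt (\<alpha>\<^sup>2 - P\<^sup>2)"
    unfolding h using assms
    by (subst (1 2) csqrt_imaginary(2)) (auto simp: complex_eq_iff e algebra_simps power2_eq_square)
  show "\<bar>\<alpha>\<bar> < P \<Longrightarrow> Re (hsqrt (\<i> * \<alpha>) P) > 0"
    unfolding h using assms
    by (subst csqrt_imaginary(1), simp, subst csqrt_imaginary(2))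
       (auto intro!: add_pos_pos)
qed

lemma tendsto_hsqrt:
  assumes "Re a = 0"
  shows "((\<lambda>\<epsilon>::real. hsqrt (a + of_real (c * \<epsilon>)) P) \<longlongrightarrow> hsqrt a P) (at_right 0)"
proof -
  have np: "z \<notin> \<real>\<^sub>\<le>\<^sub>0 \<or> z = 0" if "Re z = 0" for z
    using that by (auto simp: complex_nonpos_Reals_iff complex_eq_iff)
  have "((\<lambda>\<epsilon>::real. csqrt (z + of_real (c * \<epsilon>))) \<longlongrightarrow> csqrt z) (at_right 0)" if "Re z = 0" for z
  proof (rule isCont_tendsto_compose[OF csqrt_continuous_at[OF np[OF that]]])
    have "((\<lambda>\<epsilon>::real. z + of_real (c * \<epsilon>)) \<longlongrightarrow> z + of_real (c * 0)) (at_right 0)"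
      by (intro tendsto_intros)
    then show "((\<lambda>\<epsilon>::real. z + of_real (c * \<epsilon>)) \<longlongrightarrow> z) (at_right 0)" by simp
  qed
  from tendsto_mult[OF this this, of "a + \<i> * P" "a - \<i> * P"] assms
  show ?thesis by (simp add: hsqrt_def algebra_simps)
qed

section \<open>The dispersion relation\<close>

definition tang_inner :: "real^3^3 \<Rightarrow> real \<Rightarrow> real \<Rightarrow> real" where
  "tang_inner F w2 w3 = F $ 1 \<bullet> tang F w2 w3"

definition dispersion :: "real \<Rightarrow> real^3^3 \<Rightarrow> complex \<Rightarrow> complex \<Rightarrow> real \<Rightarrow> real \<Rightarrow> complex" where
  "dispersion M F s l w2 w3 = complex_of_real ((beta M F)\<^sup>2) * l\<^sup>2 - 2 * (M\<^sup>2 * s - \<i> * tang_inner F w2 w3) * l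
     - (M\<^sup>2 * s\<^sup>2 + complex_of_real ((norm (tang F w2 w3))\<^sup>2 + (w2\<^sup>2 + w3\<^sup>2)))"

lemma ell_eq_tang_inner: "w2 * ell F 2 + w3 * ell F 3 = tang_inner F w2 w3"
  by (simp add: ell_def tang_inner_def tang_def inner_add_right)

lemma norm_vec_3_squared: "(norm (x :: real^3))\<^sup>2 = (x $ 1)\<^sup>2 + (x $ 2)\<^sup>2 + (x $ 3)\<^sup>2"
  unfolding power2_norm_eq_inner by (simp add: inner_vec_def sum_3 power2_eq_square)

lemma sum_strain:
  fixes l :: complex
  shows "(\<Sum>j\<in>UNIV. F $ 1 $ j * strain F l w2 w3 $ j)
      = complex_of_real ((M1 F)\<^sup>2) * l + \<i> * tang_inner F w2 w3"
    and "(\<Sum>j\<in>UNIV. tang F w2 w3 $ j * strain F l w2 w3 $ j)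
      = l * tang_inner F w2 w3 + \<i> * complex_of_real ((norm (tang F w2 w3))\<^sup>2)"
    and "(\<Sum>j\<in>UNIV. (strain F l w2 w3 $ j)\<^sup>2)
      = complex_of_real ((M1 F)\<^sup>2) * l\<^sup>2 + 2 * (\<i> * tang_inner F w2 w3) * l
        - complex_of_real ((norm (tang F w2 w3))\<^sup>2)"
  unfolding M1_def norm_vec_3_squared
  by (simp_all add: strain_def tang_inner_def sum_3 inner_vec_def
      algebra_simps power2_eq_square)

lemma inner_real_3: "(x :: real^3) \<bullet> y = x $ 1 * y $ 1 + x $ 2 * y $ 2 + x $ 3 * y $ 3"
  by (simp add: inner_vec_def sum_3)

text \<open>Here \<open>c\<close> stands for \<open>i m\<close>, \<open>e\<close> for \<open>1 - d\<^sub>0 = a\<^sub>0 / R\<close>, \<open>n\<close> for \<open>M\<^sup>2\<close> and \<open>\<mu>\<close> for \<open>M\<^sub>1\<^sup>2\<close>.\<close>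

lemma lopatinski_identity:
  fixes s l :: complex
  assumes b: "b = 1 + \<mu> - n" "b = - (2 * n * e)" and t: "n * t = c"
    and disp: "b * l\<^sup>2 - 2 * (n * s - c) * l - (n * s\<^sup>2 + (w + \<omega>)) = 0"
  shows "((s - t) + (- (1 - e) * s + t)) * (l\<^sup>2 - \<omega>)
      - (s + l) * (l * (n * (- (1 - e) * s + t) + (s - t) - (- (s - t) * \<mu> + e * c)) - e * r * \<omega> * (n - \<mu>))
      - l * ((- (s - t) * (\<mu> * l + c) + e * (l * c - w)) - (\<mu> * l + c) * (- (1 - e) * s + t))
    = e * (s + l) * (b * l\<^sup>2 + \<omega> * (r * (n - \<mu>) - 1))"
proof -
  have \<mu>: "\<mu> = n - 1 - 2 * n * e" using b by (simp add: algebra_simps)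
  \<comment> \<open>The dispersion relation is linear in \<open>w\<close>; solving for it leaves a
    plain polynomial identity.\<close>
  have w: "w = - 2 * n * e * l\<^sup>2 - 2 * (n * s - n * t) * l - n * s\<^sup>2 - \<omega>"
    using disp unfolding b(2) t[symmetric] by algebra
  show ?thesis
    unfolding b(2) w t[symmetric] \<mu> by algebra
qed

section \<open>Scalar quantities of a Lax shock\<close>

locale lax_shock =
  fixes M R :: real and F :: "real^3^3"
  assumes M1_less: "M1 F < M" and M_less: "M < Mstar F" and R_pos: "R > 0"
begin

definition defect :: real where
  "defect = R * (M\<^sup>2 - (M1 F)\<^sup>2) - 1"

definition radical :: "real \<Rightarrow> real \<Rightarrow> real" where
  "radical w2 w3 = sqrt ((Mstar F)\<^sup>2 * ((norm (tang F w2 w3))\<^sup>2 + (w2\<^sup>2 + w3\<^sup>2)) - (tang_inner F w2 w3)\<^sup>2)"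

text \<open>The threshold P of the overview.\<close>

definition cutoff :: "real \<Rightarrow> real \<Rightarrow> real" where
  "cutoff w2 w3 = beta M F * radical w2 w3 / Mstar F"

definition drift :: "complex \<Rightarrow> real \<Rightarrow> real \<Rightarrow> complex" where
  "drift s w2 w3 = complex_of_real (M\<^sup>2) * s - \<i> * tang_inner F w2 w3"

text \<open>The shift by m completes the square in \<open>s\<close>: the discriminant of the
  dispersion relation becomes \<open>freq\<close> squared plus the constant \<open>cutoff\<close>
  squared.\<close>

definition freq :: "complex \<Rightarrow> real \<Rightarrow> real \<Rightarrow> complex" where
  "freq s w2 w3 = complex_of_real (M * Mstar F) * s - \<i> * complex_of_real (M * tang_inner F w2 w3 / Mstar F)"

definition mode_root :: "complex \<Rightarrow> real \<Rightarrow> real \<Rightarrow> complex" where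
  "mode_root s w2 w3 =
     (drift s w2 w3 + hsqrt (freq s w2 w3) (cutoff w2 w3)) / complex_of_real ((beta M F)\<^sup>2)"

lemma M1_nonneg: "0 \<le> M1 F"
  by (simp add: M1_def)

lemma M_pos: "0 < M"
  using M1_less M1_nonneg by linarith

lemma Mstar_squared: "(Mstar F)\<^sup>2 = 1 + (M1 F)\<^sup>2"
  by (simp add: Mstar_def add_nonneg_nonneg)

lemma Mstar_pos: "0 < Mstar F"
  using M_pos M_less by linarith

lemma M1_squared_less: "(M1 F)\<^sup>2 < M\<^sup>2"
  using M1_less M1_nonneg by (intro power_strict_mono) auto

lemma M_squared_less: "M\<^sup>2 < (Mstar F)\<^sup>2"
  using M_less M_pos by (intro power_strict_mono) auto

lemma beta_squared: "(beta M F)\<^sup>2 = (Mstar F)\<^sup>2 - M\<^sup>2"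
  using M_squared_less by (simp add: beta_def)

lemma beta_pos: "0 < beta M F"
  using M_squared_less by (simp add: beta_def)

lemma defect_gt: "defect > -1"
  using R_pos M1_squared_less by (simp add: defect_def)

lemma tang_inner_squared_le: "(tang_inner F w2 w3)\<^sup>2 \<le> (M1 F)\<^sup>2 * (norm (tang F w2 w3))\<^sup>2"
  unfolding tang_inner_def M1_def using Cauchy_Schwarz_ineq[of "F $ 1" "tang F w2 w3"]
  by (simp add: power2_norm_eq_inner)

lemma tang_inner_squared_le': "(tang_inner F w2 w3)\<^sup>2 \<le> M\<^sup>2 * (norm (tang F w2 w3))\<^sup>2"
  using tang_inner_squared_le[of w2 w3] mult_right_mono[of "(M1 F)\<^sup>2" "M\<^sup>2" "(norm (tang F w2 w3))\<^sup>2"]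
    M1_squared_less by simp

text \<open>By Cauchy-Schwarz the expression under the root is nonnegative.\<close>

lemma radical_squared:
  "(radical w2 w3)\<^sup>2 = (Mstar F)\<^sup>2 * ((norm (tang F w2 w3))\<^sup>2 + (w2\<^sup>2 + w3\<^sup>2)) - (tang_inner F w2 w3)\<^sup>2"
proof -
  have "0 \<le> (Mstar F)\<^sup>2 * ((norm (tang F w2 w3))\<^sup>2 + (w2\<^sup>2 + w3\<^sup>2)) - (tang_inner F w2 w3)\<^sup>2"
    using tang_inner_squared_le[of w2 w3] by (simp add: Mstar_squared algebra_simps add_nonneg_nonneg add_increasing)
  then show ?thesis by (simp add: radical_def)
qed

lemma radical_nonneg: "0 \<le> radical w2 w3"
proof -
  have "0 \<le> (Mstar F)\<^sup>2 * ((norm (tang F w2 w3))\<^sup>2 + (w2\<^sup>2 + w3\<^sup>2)) - (tang_inner F w2 w3)\<^sup>2"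
    using radical_squared by (metis zero_le_power2)
  then show ?thesis by (simp add: radical_def)
qed

text \<open>The first two terms on the right are k . k for k = \<open>wavevec l w2 w3\<close>, so on
  the dispersion relation the shear factor reduces to k . k.\<close>

lemma shear_eq:
  "shear M F s l w2 w3 = l\<^sup>2 - complex_of_real (w2\<^sup>2 + w3\<^sup>2) - dispersion M F s l w2 w3"
  unfolding shear_def sum_strain dispersion_def beta_squared Mstar_squared
  by (simp add: algebra_simps power2_eq_square)

text \<open>If the shear factor vanishes, then \<open>v = 1\<close>, \<open>f = q / \<sigma>\<close> with \<open>\<sigma> = s + l\<close> is a plane shear wave,
  whose energy \<open>M\<^sup>2 + |f|\<^sup>2\<close> dominates its flux as \<open>M\<^sub>1 < M\<close>.\<close>

lemma shear_nonzero:
  assumes s: "Re s \<ge> 0" and l: "Re l > 0"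
  shows "shear M F s l w2 w3 \<noteq> 0"
proof
  assume 0: "shear M F s l w2 w3 = 0"
  define \<sigma> where "\<sigma> = s + l"
  define q where "q = strain F l w2 w3"
  define f where "f j = q $ j / \<sigma>" for j
  define S where "S = (\<Sum>j\<in>UNIV. (norm (f j))\<^sup>2)"
  define g :: "real^3" where "g = (\<chi> j. Re (f j))"
  have \<sigma>: "Re \<sigma> \<ge> Re l" "\<sigma> \<noteq> 0" using s l by (auto simp: \<sigma>_def complex_eq_iff)
  have qf: "q $ j = \<sigma> * f j" for j using \<sigma> by (simp add: f_def)
  have "\<sigma> * (\<sigma> * M\<^sup>2) = \<sigma> * (\<Sum>j\<in>UNIV. q $ j * f j)"
    using 0 unfolding shear_def q_def[symmetric] \<sigma>_def[symmetric]
    by (simp add: sum_distrib_left power_mult_distrib power2_eq_square qf mult_ac)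
  then have "\<sigma> * M\<^sup>2 = (\<Sum>j\<in>UNIV. q $ j * f j)" using \<sigma> by simp
  moreover have "\<sigma> * S = (\<Sum>j\<in>UNIV. q $ j * cnj (f j))"
    by (simp add: S_def sum_distrib_left qf mult.assoc flip: complex_norm_square)
  \<comment> \<open>Adding the two identities pairs q with the real vector 2 Re f, so that taking
    real parts discards the term i W of the strain.\<close>
  ultimately have "\<sigma> * (M\<^sup>2 + S) = (\<Sum>j\<in>UNIV. q $ j * (f j + cnj (f j)))"
    by (simp add: sum.distrib algebra_simps)
  then have "Re (\<sigma> * of_real (M\<^sup>2 + S)) = Re (\<Sum>j\<in>UNIV. q $ j * of_real (2 * Re (f j)))"
    by (simp add: complex_add_cnj)
  then have E: "Re \<sigma> * (M\<^sup>2 + S) = 2 * Re l * (F $ 1 \<bullet> g)"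
    by (simp add: q_def strain_def g_def inner_real_3 sum_3 algebra_simps)
  have gS: "(norm g)\<^sup>2 \<le> S"
    by (simp add: norm_vec_3_squared g_def S_def sum_3 cmod_power2)
  have "F $ 1 \<bullet> g \<le> M1 F * norm g"
    unfolding M1_def by (rule norm_cauchy_schwarz)
  moreover have "2 * (M1 F * norm g) \<le> (M1 F)\<^sup>2 + (norm g)\<^sup>2"
    using sum_squares_bound[of "M1 F" "norm g"] by (simp add: mult.assoc)
  ultimately have "2 * (F $ 1 \<bullet> g) < M\<^sup>2 + S"
    using gS M1_squared_less by linarith
  then have "Re l * (2 * (F $ 1 \<bullet> g)) < Re l * (M\<^sup>2 + S)"
    using l by simp
  moreover have "Re l * (M\<^sup>2 + S) \<le> Re \<sigma> * (M\<^sup>2 + S)"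
    using \<sigma> gS by (intro mult_right_mono) (auto intro: add_nonneg_nonneg order_trans[OF zero_le_power2])
  ultimately show False using E by simp
qed

section \<open>Selecting the decaying root\<close>

lemma beta_dispersion:
  "complex_of_real ((beta M F)\<^sup>2) * dispersion M F s l w2 w3
     = (complex_of_real ((beta M F)\<^sup>2) * l - drift s w2 w3)\<^sup>2
       - ((freq s w2 w3)\<^sup>2 + (complex_of_real (cutoff w2 w3))\<^sup>2)"
proof -
  define y where "y = tang_inner F w2 w3 / Mstar F"
  define Q where "Q = (norm (tang F w2 w3))\<^sup>2 + (w2\<^sup>2 + w3\<^sup>2)"
  have m: "tang_inner F w2 w3 = y * Mstar F" and My: "M * (y * Mstar F) / Mstar F = M * y"
    using Mstar_pos by (simp_all add: y_def)
  have "(cutoff w2 w3)\<^sup>2 = (beta M F)\<^sup>2 * (Q - y\<^sup>2)"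
    using Mstar_pos unfolding cutoff_def power_divide power_mult_distrib radical_squared m Q_def[symmetric]
    by (simp add: field_simps)
  then have cut: "(complex_of_real (cutoff w2 w3))\<^sup>2
      = ((of_real (Mstar F))\<^sup>2 - (of_real M)\<^sup>2) * (of_real Q - (of_real y)\<^sup>2)"
    by (simp add: beta_squared flip: of_real_power)
  show ?thesis
    unfolding cut dispersion_def drift_def freq_def Q_def[symmetric] m My beta_squared
      of_real_mult of_real_diff of_real_power
    by (simp add: power2_diff power2_sum power_mult_distrib algebra_simps) (simp add: algebra_simps power2_eq_square)
qed

lemma dispersion_eq_0_iff:
  "dispersion M F s l w2 w3 = 0 \<longleftrightarrow>
     complex_of_real ((beta M F)\<^sup>2) * l = drift s w2 w3 + hsqrt (freq s w2 w3) (cutoff w2 w3) \<or>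
     complex_of_real ((beta M F)\<^sup>2) * l = drift s w2 w3 - hsqrt (freq s w2 w3) (cutoff w2 w3)"
  (is "_ \<longleftrightarrow> ?b * l = ?X + ?G \<or> ?b * l = ?X - ?G")
proof -
  have "dispersion M F s l w2 w3 = 0 \<longleftrightarrow> ?b * dispersion M F s l w2 w3 = 0"
    using beta_pos by simp
  also have "\<dots> \<longleftrightarrow> (?b * l - ?X)\<^sup>2 = ?G\<^sup>2"
    unfolding beta_dispersion hsqrt_squared by simp
  also have "\<dots> \<longleftrightarrow> ?b * l = ?X + ?G \<or> ?b * l = ?X - ?G"
    unfolding power2_eq_iff by (auto simp: algebra_simps)
  finally show ?thesis .
qed

lemma beta_mode_root:
  "complex_of_real ((beta M F)\<^sup>2) * mode_root s w2 w3 = drift s w2 w3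
     + hsqrt (freq s w2 w3) (cutoff w2 w3)"
  using beta_pos by (simp add: mode_root_def)

lemma dispersion_mode_root: "dispersion M F s (mode_root s w2 w3) w2 w3 = 0"
  unfolding dispersion_eq_0_iff beta_mode_root by simp

lemma Re_hsqrt_mode:
  assumes "Re s \<ge> 0"
  shows "M * Mstar F * Re s
     \<le> Re (hsqrt (freq s w2 w3) (cutoff w2 w3))"
  using Re_hsqrt_ge[of "freq s w2 w3" "cutoff w2 w3"] assms M_pos Mstar_pos
  by (simp add: freq_def)

lemma Re_mode_root:
  assumes "Re s \<ge> 0"
  shows "(beta M F)\<^sup>2 * Re (mode_root s w2 w3) \<ge> M * Mstar F * Re s"
proof -
  have "(beta M F)\<^sup>2 * Re (mode_root s w2 w3) = Re (of_real ((beta M F)\<^sup>2) * mode_root s w2 w3)"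
    by simp
  also have "\<dots> = M\<^sup>2 * Re s + Re (hsqrt (freq s w2 w3) (cutoff w2 w3))"
    unfolding beta_mode_root by (simp add: drift_def)
  also have "\<dots> \<ge> M * Mstar F * Re s"
    using Re_hsqrt_mode[OF assms, of w2 w3] assms by (simp add: add_increasing)
  finally show ?thesis .
qed

lemma Re_mode_root_nonneg:
  assumes "Re s \<ge> 0"
  shows "Re (mode_root s w2 w3) \<ge> 0"
proof -
  have "0 \<le> M * Mstar F * Re s" using assms M_pos Mstar_pos by simp
  also note Re_mode_root[OF assms]
  finally show ?thesis using beta_pos by (simp add: zero_le_mult_iff)
qed

lemma Re_mode_root_pos:
  assumes "Re s > 0"
  shows "Re (mode_root s w2 w3) > 0"
proof -
  have "0 < M * Mstar F * Re s" using assms M_pos Mstar_pos by simp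
  also have "\<dots> \<le> (beta M F)\<^sup>2 * Re (mode_root s w2 w3)"
    using Re_mode_root assms by simp
  finally show ?thesis using beta_pos by (simp add: zero_less_mult_iff)
qed

text \<open>The symbol is itself with its first row replaced by that row, so the pairing with
  \<open>mode\<close> is the pressure component of symbol times mode.\<close>

lemma det_symbol_eq_0_iff:
  assumes "Re s \<ge> 0" "Re l > 0"
  shows "det (symbol M F s l w2 w3) = 0 \<longleftrightarrow> dispersion M F s l w2 w3 = 0"
proof -
  have \<sigma>: "s + l \<noteq> 0" using assms by (auto simp: complex_eq_iff)
  have "det (symbol M F s l w2 w3) = 0
    \<longleftrightarrow> det (\<chi> a. if a = Pres then symbol M F s l w2 w3 $ Pres else symbol M F s l w2 w3 $ a) = 0"
    by (rule arg_cong[of _ _ "\<lambda>A. det A = 0"]) (simp add: vec_eq_iff)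
  also have "\<dots> \<longleftrightarrow> (symbol M F s l w2 w3 *v mode M F s l w2 w3) $ Pres = 0"
    unfolding det_replace_first_row[OF \<sigma> shear_nonzero[OF assms]] by (simp add: matrix_vector_mult_def)
  also have "(symbol M F s l w2 w3 *v mode M F s l w2 w3) $ Pres = - ((s + l) * dispersion M F s l w2 w3)"
    unfolding symbol_mult by (simp add: mode_def sum_3 shear_eq algebra_simps power2_eq_square)
  finally show ?thesis using \<sigma> by (simp only: neg_equal_0_iff_equal mult_eq_0_iff simp_thms)
qed

text \<open>The root with the plus sign has positive real part. The other one is ruled out by
  \<open>Re_hsqrt_mode\<close>: beta^2 times its real part is at most M^2 \<eta> - M Mstar \<eta>,
  which is not positive as M < Mstar.\<close>

lemma lambda_interior_eq:
  assumes "\<eta> > 0"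
  shows "lambda_interior M F \<eta> \<xi> w2 w3 = mode_root (Complex \<eta> \<xi>) w2 w3"
  unfolding lambda_interior_def
proof (rule the_equality)
  let ?s = "Complex \<eta> \<xi>"
  show "Re (mode_root ?s w2 w3) > 0 \<and> det (symbol M F ?s (mode_root ?s w2 w3) w2 w3) = 0"
    using assms by (simp add: Re_mode_root_pos det_symbol_eq_0_iff dispersion_mode_root)
next
  fix l
  let ?s = "Complex \<eta> \<xi>"
  define X where "X = drift ?s w2 w3"
  define G where "G = hsqrt (freq ?s w2 w3) (cutoff w2 w3)"
  assume "Re l > 0 \<and> det (symbol M F ?s l w2 w3) = 0"
  then have l: "Re l > 0" and "dispersion M F ?s l w2 w3 = 0"
    using assms det_symbol_eq_0_iff[of ?s l] by auto
  then consider "complex_of_real ((beta M F)\<^sup>2) * l = X + G" | "complex_of_real ((beta M F)\<^sup>2) * l = X - G"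
    unfolding dispersion_eq_0_iff X_def G_def by blast
  then show "l = mode_root ?s w2 w3"
  proof cases
    case 1
    then have "complex_of_real ((beta M F)\<^sup>2) * l = complex_of_real ((beta M F)\<^sup>2) * mode_root ?s w2 w3"
      unfolding beta_mode_root X_def G_def .
    then show ?thesis using beta_pos by simp
  next
    case 2
    have "(beta M F)\<^sup>2 * Re l = Re (of_real ((beta M F)\<^sup>2) * l)" by simp
    also have "\<dots> = M\<^sup>2 * \<eta> - Re G" unfolding 2 by (simp add: X_def drift_def)
    also have "\<dots> \<le> M\<^sup>2 * \<eta> - M * Mstar F * \<eta>"
      using Re_hsqrt_mode[of ?s w2 w3] assms by (simp add: G_def)
    also have "\<dots> \<le> 0" using M_less M_pos assms by (simp add: power2_eq_square)
    finally show ?thesis using l beta_pos by (simp add: mult_le_0_iff)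
  qed
qed

text \<open>Moving off the boundary by \<epsilon> changes \<open>freq\<close> by a positive real
  multiple of \<epsilon>, so the limit reduces to the one-sided continuity of \<open>hsqrt\<close>
  on the imaginary axis.\<close>

lemma lambda_plus_eq:
  assumes "\<eta> \<ge> 0"
  shows "lambda_plus M F \<eta> \<xi> w2 w3 = mode_root (Complex \<eta> \<xi>) w2 w3"
proof (cases "\<eta> = 0")
  case False
  then show ?thesis using assms by (simp add: lambda_plus_def lambda_interior_eq)
next
  case True
  have C: "Complex \<epsilon> \<xi> = Complex 0 \<xi> + of_real \<epsilon>" for \<epsilon>
    by (simp add: complex_eq_iff)
  have root: "mode_root (Complex \<epsilon> \<xi>) w2 w3
      = (drift (Complex 0 \<xi> + of_real \<epsilon>) w2 w3
         + hsqrt (freq (Complex 0 \<xi>) w2 w3 + of_real (M * Mstar F * \<epsilon>)) (cutoff w2 w3))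
        / complex_of_real ((beta M F)\<^sup>2)" for \<epsilon>
    unfolding mode_root_def C[of \<epsilon>] by (simp add: freq_def algebra_simps)
  have "((\<lambda>\<epsilon>. mode_root (Complex \<epsilon> \<xi>) w2 w3) \<longlongrightarrow>
      (drift (Complex 0 \<xi> + of_real 0) w2 w3 + hsqrt (freq (Complex 0 \<xi>) w2 w3) (cutoff w2 w3))
        / complex_of_real ((beta M F)\<^sup>2)) (at_right 0)"
    unfolding root drift_def using beta_pos
    by (intro tendsto_intros tendsto_hsqrt) (simp_all add: freq_def)
  also have "(drift (Complex 0 \<xi> + of_real 0) w2 w3 + hsqrt (freq (Complex 0 \<xi>) w2 w3) (cutoff w2 w3))
        / complex_of_real ((beta M F)\<^sup>2) = mode_root (Complex 0 \<xi>) w2 w3"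
    by (simp add: mode_root_def)
  finally have "((\<lambda>\<epsilon>. lambda_interior M F \<epsilon> \<xi> w2 w3) \<longlongrightarrow> mode_root (Complex 0 \<xi>) w2 w3) (at_right 0)"
    by (rule Lim_transform_eventually)
       (auto simp: eventually_at_filter lambda_interior_eq)
  then show ?thesis
    using True by (simp add: lambda_plus_def tendsto_Lim)
qed


section \<open>The Lopatinski determinant\<close>

text \<open>The deformation gradient enters only through M1^2, m and |W|^2. The pairing is thus a
  polynomial in scalars, and \<open>lopatinski_identity\<close> factors it.\<close>

lemma sum_U0_mode:
  assumes disp: "dispersion M F s l w2 w3 = 0"
  shows "(\<Sum>c\<in>UNIV. (cmat (Amat M F 1) *v U0 M R F s w2 w3) $ c * mode M F s l w2 w3 $ c)
    = complex_of_real (- (beta M F)\<^sup>2 / (2 * M\<^sup>2)) * (s + l)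
      * (complex_of_real ((beta M F)\<^sup>2) * l\<^sup>2 + complex_of_real ((w2\<^sup>2 + w3\<^sup>2) * defect))"
proof -
  define n where "n = complex_of_real (M\<^sup>2)"
  define \<mu> where "\<mu> = complex_of_real ((M1 F)\<^sup>2)"
  define b where "b = complex_of_real ((beta M F)\<^sup>2)"
  define e where "e = complex_of_real (- (beta M F)\<^sup>2 / (2 * M\<^sup>2))"
  define c where "c = \<i> * tang_inner F w2 w3"
  define t where "t = c / n"
  define r where "r = complex_of_real R"
  define \<omega> where "\<omega> = complex_of_real (w2\<^sup>2 + w3\<^sup>2)"
  define w where "w = complex_of_real ((norm (tang F w2 w3))\<^sup>2)"
  define u where "u = U0 M R F s w2 w3"
  define q where "q = strain F l w2 w3"
  have n: "n \<noteq> 0" using M_pos by (simp add: n_def)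
  \<comment> \<open>Two expressions for beta^2: one from its definition, the other from e = a0 /
    R.\<close>
  have b1: "b = 1 + \<mu> - n"
    by (simp add: b_def \<mu>_def n_def beta_squared Mstar_squared)
  have "(beta M F)\<^sup>2 = - (2 * M\<^sup>2 * (- (beta M F)\<^sup>2 / (2 * M\<^sup>2)))"
    using M_pos by simp
  from arg_cong[OF this, of complex_of_real] have b2: "b = - (2 * n * e)"
    unfolding b_def n_def e_def by (simp only: of_real_minus of_real_mult of_real_numeral)
  have d: "b * l\<^sup>2 - 2 * (n * s - c) * l - (n * s\<^sup>2 + (w + \<omega>)) = 0"
    using disp by (simp add: dispersion_def b_def n_def c_def w_def \<omega>_def)
  have a0: "complex_of_real (a0 M R F) = e * r" "complex_of_real (a0 M R F) / r = e"
    using R_pos by (simp_all add: a0_def e_def r_def)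
  have "d0 M F = 1 - - (beta M F)\<^sup>2 / (2 * M\<^sup>2)"
    using d0_a0[of M R F] M_pos R_pos M_less by (simp add: a0_def)
  then have d0: "complex_of_real (d0 M F) = 1 - e"
    by (simp only: e_def of_real_diff of_real_1)
  have tt: "\<i> * complex_of_real (w2 * ell F 2 + w3 * ell F 3) / complex_of_real (M\<^sup>2) = t"
    by (simp add: ell_eq_tang_inner t_def c_def n_def)
  have uP: "u $ Pres = s - t"
    using tt by (simp add: u_def U0_def Let_def)
  have uV: "u $ Vel 1 = - (1 - e) * s + t" "u $ Vel 2 = \<i> * (e * r) * w2" "u $ Vel 3 = \<i> * (e * r) * w3"
    unfolding mult_minus_left using tt d0 a0 by (simp_all add: u_def U0_def Let_def)
  have uD: "u $ Dgr 1 j = - (s - t) * F $ 1 $ j + \<i> * e * tang F w2 w3 $ j"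
    "u $ Dgr 2 j = u $ Vel 2 * F $ 1 $ j" "u $ Dgr 3 j = u $ Vel 3 * F $ 1 $ j" for j
    using tt a0 R_pos by (simp_all add: u_def U0_def Let_def tang_def r_def algebra_simps)
  have \<phi>: "(\<Sum>j\<in>UNIV. F $ 1 $ j * q $ j) = \<mu> * l + c"
    unfolding q_def sum_strain \<mu>_def c_def ..
  have \<mu>': "(\<Sum>j\<in>UNIV. complex_of_real (F $ 1 $ j) * F $ 1 $ j) = \<mu>"
    unfolding \<mu>_def M1_def norm_vec_3_squared by (simp add: sum_3 power2_eq_square)
  have c': "(\<Sum>j\<in>UNIV. complex_of_real (F $ 1 $ j) * tang F w2 w3 $ j) = tang_inner F w2 w3"
    by (simp add: tang_inner_def inner_real_3 sum_3)
  have g1: "(\<Sum>j\<in>UNIV. F $ 1 $ j * u $ Dgr 1 j) = - (s - t) * \<mu> + e * c"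
  proof -
    have "(\<Sum>j\<in>UNIV. F $ 1 $ j * u $ Dgr 1 j) = - (s - t) * (\<Sum>j\<in>UNIV. complex_of_real (F $ 1 $ j) * F $ 1 $ j)
        + \<i> * e * (\<Sum>j\<in>UNIV. complex_of_real (F $ 1 $ j) * tang F w2 w3 $ j)"
      by (simp add: uD sum_3 algebra_simps)
    then show ?thesis unfolding \<mu>' c' c_def by simp
  qed
  have h1: "(\<Sum>j\<in>UNIV. u $ Dgr 1 j * q $ j) = - (s - t) * (\<mu> * l + c) + e * (l * c - w)"
  proof -
    have "(\<Sum>j\<in>UNIV. u $ Dgr 1 j * q $ j) = - (s - t) * (\<Sum>j\<in>UNIV. F $ 1 $ j * q $ j)
        + \<i> * e * (\<Sum>j\<in>UNIV. tang F w2 w3 $ j * q $ j)"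
      by (simp add: uD sum_3 algebra_simps)
    moreover have "\<i> * (\<Sum>j\<in>UNIV. tang F w2 w3 $ j * q $ j) = l * c - w"
      unfolding q_def sum_strain by (simp add: c_def w_def algebra_simps)
    ultimately show ?thesis unfolding \<phi> by (simp only: mult.assoc mult.left_commute[of \<i> e])
  qed
  have gk: "(\<Sum>j\<in>UNIV. F $ 1 $ j * (x * F $ 1 $ j)) = x * \<mu>" for x :: complex
    unfolding \<mu>'[symmetric] by (simp add: sum_distrib_left mult_ac)
  have hk: "(\<Sum>j\<in>UNIV. x * F $ 1 $ j * q $ j) = x * (\<mu> * l + c)" for x :: complex
    unfolding \<phi>[symmetric] by (simp add: sum_distrib_left mult_ac)
  have N: "shear M F s l w2 w3 = l\<^sup>2 - \<omega>"
    unfolding shear_eq disp by (simp add: \<omega>_def)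
  have k: "(\<Sum>i\<in>UNIV. wavevec l w2 w3 $ i * (n * u $ Vel i + (if i = 1 then u $ Pres else 0)
          - (\<Sum>j\<in>UNIV. F $ 1 $ j * u $ Dgr i j)))
      = l * (n * u $ Vel 1 + u $ Pres - (- (s - t) * \<mu> + e * c)) - e * r * \<omega> * (n - \<mu>)"
    unfolding sum_3[of "\<lambda>i. wavevec l w2 w3 $ i * X i" for X] g1 uD(2,3) gk
    by (simp add: uV \<omega>_def algebra_simps power2_eq_square)
  have k': "(\<Sum>i\<in>UNIV. wavevec l w2 w3 $ i * ((\<Sum>j\<in>UNIV. u $ Dgr i j * q $ j) - (\<mu> * l + c) * u $ Vel i))
     = l * ((- (s - t) * (\<mu> * l + c) + e * (l * c - w)) - (\<mu> * l + c) * u $ Vel 1)"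
    unfolding sum_3[of "\<lambda>i. wavevec l w2 w3 $ i * X i" for X] h1 uD(2,3) hk by simp
  have "(\<Sum>c\<in>UNIV. (cmat (Amat M F 1) *v u) $ c * mode M F s l w2 w3 $ c)
    = (u $ Pres + u $ Vel 1) * (l\<^sup>2 - \<omega>)
      - (s + l) * (l * (n * u $ Vel 1 + u $ Pres - (- (s - t) * \<mu> + e * c)) - e * r * \<omega> * (n - \<mu>))
      - l * ((- (s - t) * (\<mu> * l + c) + e * (l * c - w)) - (\<mu> * l + c) * u $ Vel 1)"
    unfolding sum_Amat_1_mode q_def[symmetric] N \<phi> n_def[symmetric] k k' ..
  also have "\<dots> = e * (s + l) * (b * l\<^sup>2 + \<omega> * (r * (n - \<mu>) - 1))"
    unfolding uP uV(1) using n by (intro lopatinski_identity[OF b1 b2 _ d]) (simp add: t_def)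
  also have "\<omega> * (r * (n - \<mu>) - 1) = complex_of_real ((w2\<^sup>2 + w3\<^sup>2) * defect)"
    by (simp add: defect_def \<omega>_def r_def n_def \<mu>_def)
  finally show ?thesis unfolding u_def e_def b_def .
qed

text \<open>If s + l = 0, then Re l >= 0 forces s = i \<xi> and l = - i \<xi>. The shear factor is
  then |W - \<xi> F_1|^2 by definition and - \<xi>^2 - |\<omega>|^2 by the dispersion relation, so
  all frequencies vanish.\<close>

lemma sum_mode_root_nonzero:
  assumes "\<eta> \<ge> 0" and nz: "\<eta>\<^sup>2 + \<xi>\<^sup>2 + (w2\<^sup>2 + w3\<^sup>2) \<noteq> 0"
  shows "Complex \<eta> \<xi> + mode_root (Complex \<eta> \<xi>) w2 w3 \<noteq> 0"
proof
  define l where "l = mode_root (Complex \<eta> \<xi>) w2 w3"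
  assume "Complex \<eta> \<xi> + mode_root (Complex \<eta> \<xi>) w2 w3 = 0"
  then have \<sigma>: "Complex \<eta> \<xi> + l = 0" by (simp add: l_def)
  have "Re l \<ge> 0" using assms by (simp add: l_def Re_mode_root_nonneg)
  then have \<eta>: "\<eta> = 0" and l: "l = - (\<i> * \<xi>)" using \<sigma> assms by (simp_all add: complex_eq_iff)
  have "shear M F (Complex \<eta> \<xi>) l w2 w3 = l\<^sup>2 - complex_of_real (w2\<^sup>2 + w3\<^sup>2)"
    unfolding shear_eq l_def dispersion_mode_root by simp
  moreover have "shear M F (Complex \<eta> \<xi>) l w2 w3 = - (\<Sum>j\<in>UNIV. (strain F l w2 w3 $ j)\<^sup>2)"
    by (simp add: shear_def \<sigma>)
  moreover have "(strain F l w2 w3 $ j)\<^sup>2 = - complex_of_real ((tang F w2 w3 $ j - \<xi> * F $ 1 $ j)\<^sup>2)" for j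
    by (simp add: strain_def l power2_eq_square algebra_simps)
  ultimately have "complex_of_real (\<Sum>j\<in>UNIV. (tang F w2 w3 $ j - \<xi> * F $ 1 $ j)\<^sup>2)
      = complex_of_real (- \<xi>\<^sup>2 - (w2\<^sup>2 + w3\<^sup>2))"
    by (simp add: l sum_negf power_mult_distrib)
  then have "(\<Sum>j\<in>UNIV. (tang F w2 w3 $ j - \<xi> * F $ 1 $ j)\<^sup>2) = - \<xi>\<^sup>2 - (w2\<^sup>2 + w3\<^sup>2)"
    by (simp only: of_real_eq_iff)
  moreover have "0 \<le> (\<Sum>j\<in>UNIV. (tang F w2 w3 $ j - \<xi> * F $ 1 $ j)\<^sup>2)"
    by (intro sum_nonneg) simp
  ultimately have "\<xi>\<^sup>2 + (w2\<^sup>2 + w3\<^sup>2) \<le> 0" by linarith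
  then have "\<xi>\<^sup>2 + (w2\<^sup>2 + w3\<^sup>2) = 0" by (intro antisym) simp_all
  with nz \<eta> show False by simp
qed

lemma mode_root_0_imp:
  assumes "mode_root s 0 0 = 0"
  shows "s = 0"
  using dispersion_mode_root[of s 0 0] assms M_pos
  by (simp add: dispersion_def tang_def)

text \<open>For Re l > 0 the energy estimate applies. For imaginary l the factor is - (Im l)^2 -
  |\<omega>|^2, whose vanishing also forces s = 0.\<close>

lemma shear_mode_root_nonzero:
  assumes "\<eta> \<ge> 0" and nz: "\<eta>\<^sup>2 + \<xi>\<^sup>2 + (w2\<^sup>2 + w3\<^sup>2) \<noteq> 0"
  shows "shear M F (Complex \<eta> \<xi>) (mode_root (Complex \<eta> \<xi>) w2 w3) w2 w3 \<noteq> 0"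
proof
  define l where "l = mode_root (Complex \<eta> \<xi>) w2 w3"
  assume "shear M F (Complex \<eta> \<xi>) (mode_root (Complex \<eta> \<xi>) w2 w3) w2 w3 = 0"
  then have N: "shear M F (Complex \<eta> \<xi>) l w2 w3 = 0" by (simp add: l_def)
  have "Re l \<ge> 0" using assms by (simp add: l_def Re_mode_root_nonneg)
  moreover have "\<not> Re l > 0"
    using shear_nonzero[of "Complex \<eta> \<xi>" l] N assms by auto
  ultimately have "l = \<i> * Im l" by (simp add: complex_eq_iff)
  then have "l\<^sup>2 = - complex_of_real ((Im l)\<^sup>2)"
    by (metis mult_minus1 of_real_power power_mult_distrib power2_i)
  moreover have "l\<^sup>2 - complex_of_real (w2\<^sup>2 + w3\<^sup>2) = 0"
    using N unfolding shear_eq l_def dispersion_mode_root by simp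
  ultimately have "complex_of_real (- (Im l)\<^sup>2 - (w2\<^sup>2 + w3\<^sup>2)) = 0" by simp
  then have "(Im l)\<^sup>2 + (w2\<^sup>2 + w3\<^sup>2) = 0" unfolding of_real_eq_0_iff by linarith
  then have "(Im l)\<^sup>2 = 0" "w2\<^sup>2 = 0" "w3\<^sup>2 = 0"
    using zero_le_power2[of "Im l"] zero_le_power2[of w2] zero_le_power2[of w3] by linarith+
  then have w: "w2 = 0" "w3 = 0" and "l = 0" using \<open>l = \<i> * Im l\<close> by simp_all
  then have "Complex \<eta> \<xi> = 0" using mode_root_0_imp by (simp add: l_def)
  with nz w show False by (simp add: complex_eq_iff)
qed

lemma det_lopatinski_eq_0_iff:
  assumes "\<eta> \<ge> 0" and nz: "\<eta>\<^sup>2 + \<xi>\<^sup>2 + (w2\<^sup>2 + w3\<^sup>2) \<noteq> 0"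
  shows "det (lopatinski_matrix M R F \<eta> \<xi> w2 w3) = 0 \<longleftrightarrow>
    complex_of_real ((beta M F)\<^sup>2) * (mode_root (Complex \<eta> \<xi>) w2 w3)\<^sup>2
      = - complex_of_real ((w2\<^sup>2 + w3\<^sup>2) * defect)"
proof -
  have "complex_of_real (- (beta M F)\<^sup>2 / (2 * M\<^sup>2)) \<noteq> 0"
    using beta_pos M_pos by simp
  then show ?thesis
    unfolding lopatinski_matrix_def Let_def lambda_plus_eq[OF assms(1)]
      det_replace_first_row[OF sum_mode_root_nonzero[OF assms] shear_mode_root_nonzero[OF assms]]
      sum_U0_mode[OF dispersion_mode_root] mult_eq_0_iff
    using sum_mode_root_nonzero[OF assms] by (simp only: add_eq_0_iff2 simp_thms)
qed


section \<open>Zeros of the Lopatinski determinant\<close>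

text \<open>After squaring this is m^2 < M^2 (|W|^2 + |\<omega>|^2), a consequence of Cauchy-Schwarz
  and M1 < M. It makes the base of the square in the criterion positive, so that square roots can be
  taken there.\<close>

lemma tang_inner_beta_less:
  assumes "w2\<^sup>2 + w3\<^sup>2 \<noteq> 0"
  shows "\<bar>tang_inner F w2 w3\<bar> * beta M F < M * radical w2 w3"
proof (rule power_less_imp_less_base)
  define Q where "Q = (norm (tang F w2 w3))\<^sup>2 + (w2\<^sup>2 + w3\<^sup>2)"
  have "0 < w2\<^sup>2 + w3\<^sup>2" using assms by (simp add: order_less_le)
  then have "M\<^sup>2 * (norm (tang F w2 w3))\<^sup>2 < M\<^sup>2 * Q"
    using M_pos by (simp add: Q_def)
  with tang_inner_squared_le'[of w2 w3] have "(tang_inner F w2 w3)\<^sup>2 < M\<^sup>2 * Q" by linarith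
  then have "(Mstar F)\<^sup>2 * (tang_inner F w2 w3)\<^sup>2 < (Mstar F)\<^sup>2 * (M\<^sup>2 * Q)"
    using Mstar_pos by simp
  then show "(\<bar>tang_inner F w2 w3\<bar> * beta M F)\<^sup>2 < (M * radical w2 w3)\<^sup>2"
    unfolding power_mult_distrib radical_squared beta_squared Q_def[symmetric]
    by (simp add: algebra_simps)
  show "0 \<le> M * radical w2 w3" using M_pos radical_nonneg by simp
qed

text \<open>The imaginary part of the dispersion relation gives M^2 |\<xi>| <= |m|, hence M^2
  \<xi>^2 <= |W|^2. In the real part |W|^2 therefore absorbs the only negative term.\<close>

lemma lopatinski_real_root:
  assumes "\<eta> \<ge> 0" and "w2\<^sup>2 + w3\<^sup>2 \<noteq> 0" and "0 < x"
    and "mode_root (Complex \<eta> \<xi>) w2 w3 = complex_of_real x"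
  shows "w2\<^sup>2 + w3\<^sup>2 \<le> (beta M F)\<^sup>2 * x\<^sup>2"
proof -
  define m where "m = tang_inner F w2 w3"
  define W where "W = (norm (tang F w2 w3))\<^sup>2"
  define \<omega> where "\<omega> = w2\<^sup>2 + w3\<^sup>2"
  define b where "b = (beta M F)\<^sup>2"
  have D: "dispersion M F (Complex \<eta> \<xi>) (complex_of_real x) w2 w3 = 0"
    using dispersion_mode_root assms(4) by metis
  have "b * x\<^sup>2 - 2 * (M\<^sup>2 * \<eta>) * x - (M\<^sup>2 * (\<eta>\<^sup>2 - \<xi>\<^sup>2) + (W + \<omega>)) = 0"
    using arg_cong[OF D, of Re] unfolding dispersion_def m_def[symmetric] b_def[symmetric]
      W_def[symmetric] \<omega>_def[symmetric]
    by (simp add: Re_power2 flip: of_real_power)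
  then have re: "b * x\<^sup>2 = 2 * (M\<^sup>2 * \<eta>) * x + M\<^sup>2 * \<eta>\<^sup>2 - M\<^sup>2 * \<xi>\<^sup>2 + (W + \<omega>)"
    by (simp add: algebra_simps)
  have im: "M\<^sup>2 * \<xi> * (x + \<eta>) = m * x"
    using arg_cong[OF D, of Im] unfolding dispersion_def m_def[symmetric] b_def[symmetric]
      W_def[symmetric] \<omega>_def[symmetric]
    by (simp add: Im_power2 algebra_simps flip: of_real_power)
  have "(M\<^sup>2 * \<bar>\<xi>\<bar>) * x \<le> (M\<^sup>2 * \<bar>\<xi>\<bar>) * (x + \<eta>)"
    using assms by (intro mult_left_mono) simp_all
  also have "\<dots> = \<bar>M\<^sup>2 * \<xi> * (x + \<eta>)\<bar>"
    using assms by (simp add: abs_mult)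
  also have "\<dots> = \<bar>m\<bar> * x" unfolding im using assms by (simp add: abs_mult)
  finally have "M\<^sup>2 * \<bar>\<xi>\<bar> \<le> \<bar>m\<bar>" using assms by simp
  then have "(M\<^sup>2 * \<bar>\<xi>\<bar>)\<^sup>2 \<le> \<bar>m\<bar>\<^sup>2" by (intro power_mono) simp_all
  also have "\<dots> \<le> M\<^sup>2 * W" using tang_inner_squared_le' by (simp add: m_def W_def)
  finally have "M\<^sup>2 * (M\<^sup>2 * \<xi>\<^sup>2) \<le> M\<^sup>2 * W"
    by (simp add: power_mult_distrib power2_eq_square mult_ac)
  then have "M\<^sup>2 * \<xi>\<^sup>2 \<le> W"
    by (rule mult_left_le_imp_le) (use M_pos in simp)
  moreover have "0 \<le> 2 * (M\<^sup>2 * \<eta>) * x + M\<^sup>2 * \<eta>\<^sup>2" using assms by simp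
  ultimately show ?thesis using re unfolding b_def \<omega>_def by linarith
qed

lemma imaginary_axis_of_defect_nonneg:
  fixes l :: complex
  assumes "complex_of_real ((beta M F)\<^sup>2) * l\<^sup>2 = - complex_of_real x" and "x \<ge> 0"
  shows "Re l = 0"
proof (rule ccontr)
  assume "Re l \<noteq> 0"
  have "(beta M F)\<^sup>2 * (2 * Re l * Im l) = 0"
    using arg_cong[OF assms(1), of Im] by (simp add: Im_power2 flip: of_real_power)
  then have "Im l = 0" using \<open>Re l \<noteq> 0\<close> beta_pos by simp
  moreover have "(beta M F)\<^sup>2 * ((Re l)\<^sup>2 - (Im l)\<^sup>2) = - x"
    using arg_cong[OF assms(1), of Re] by (simp add: Re_power2 flip: of_real_power)
  ultimately have "(beta M F)\<^sup>2 * (Re l)\<^sup>2 \<le> 0" using assms(2) by simp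
  then show False using \<open>Re l \<noteq> 0\<close> beta_pos by (simp add: mult_le_0_iff)
qed

lemma det_lopatinski_nonzero_tangential:
  assumes "\<eta> \<ge> 0" and "\<eta>\<^sup>2 + \<xi>\<^sup>2 + (w2\<^sup>2 + w3\<^sup>2) \<noteq> 0" and "w2\<^sup>2 + w3\<^sup>2 = 0"
  shows "det (lopatinski_matrix M R F \<eta> \<xi> w2 w3) \<noteq> 0"
proof
  assume "det (lopatinski_matrix M R F \<eta> \<xi> w2 w3) = 0"
  then have "mode_root (Complex \<eta> \<xi>) w2 w3 = 0"
    unfolding det_lopatinski_eq_0_iff[OF assms(1,2)] assms(3) using beta_pos by simp
  moreover have "w2 = 0" "w3 = 0" using assms(3) by (simp_all add: sum_power2_eq_zero_iff)
  ultimately have "Complex \<eta> \<xi> = 0" using mode_root_0_imp by simp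
  then show False using assms by (simp add: complex_eq_iff)
qed

lemma det_lopatinski_nonzero:
  assumes "\<eta> \<ge> 0" and nz: "\<eta>\<^sup>2 + \<xi>\<^sup>2 + (w2\<^sup>2 + w3\<^sup>2) \<noteq> 0" and "\<eta> > 0 \<or> defect < 0"
  shows "det (lopatinski_matrix M R F \<eta> \<xi> w2 w3) \<noteq> 0"
proof (cases "w2\<^sup>2 + w3\<^sup>2 = 0")
  case True
  with assms show ?thesis by (intro det_lopatinski_nonzero_tangential)
next
  case False
  define l where "l = mode_root (Complex \<eta> \<xi>) w2 w3"
  define \<omega> where "\<omega> = w2\<^sup>2 + w3\<^sup>2"
  have \<omega>: "\<omega> > 0" using False by (simp add: \<omega>_def order_less_le)
  show ?thesis
  proof
    assume "det (lopatinski_matrix M R F \<eta> \<xi> w2 w3) = 0"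
    then have l: "complex_of_real ((beta M F)\<^sup>2) * l\<^sup>2 = - complex_of_real (\<omega> * defect)"
      unfolding det_lopatinski_eq_0_iff[OF assms(1,2)] by (simp add: l_def \<omega>_def)
    have Re: "(beta M F)\<^sup>2 * ((Re l)\<^sup>2 - (Im l)\<^sup>2) = - (\<omega> * defect)"
      using arg_cong[OF l, of Re] by (simp add: Re_power2 flip: of_real_power)
    have Im: "(beta M F)\<^sup>2 * (2 * Re l * Im l) = 0"
      using arg_cong[OF l, of Im] by (simp add: Im_power2 flip: of_real_power)
    show False
    proof (cases "defect < 0")
      case True
      then have "0 < (beta M F)\<^sup>2 * ((Re l)\<^sup>2 - (Im l)\<^sup>2)"
        unfolding Re using \<omega> by (simp add: mult_pos_neg)
      then have "(Im l)\<^sup>2 < (Re l)\<^sup>2" using beta_pos by (simp add: zero_less_mult_iff)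
      then have "Re l \<noteq> 0" by (metis zero_le_power2 not_le zero_power2)
      then have "Im l = 0" using Im beta_pos by simp
      have "Re l > 0" using \<open>Re l \<noteq> 0\<close> Re_mode_root_nonneg[of "Complex \<eta> \<xi>" w2 w3] assms(1)
        by (simp add: l_def)
      moreover have "l = complex_of_real (Re l)" using \<open>Im l = 0\<close> by (simp add: complex_eq_iff)
      ultimately have "\<omega> \<le> (beta M F)\<^sup>2 * (Re l)\<^sup>2"
        using lopatinski_real_root[OF assms(1) False] by (simp add: l_def \<omega>_def)
      \<comment> \<open>The zero condition gives beta^2 (Re l)^2 = - \<omega> \<open>defect\<close>
        < \<omega>, against the bound just obtained.\<close>
      moreover have "\<omega> * -1 < \<omega> * defect" using \<omega> defect_gt by (intro mult_strict_left_mono) simp_all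
      ultimately show False using Re \<open>Im l = 0\<close> by simp
    next
      case False
      then have "Re l = 0" using imaginary_axis_of_defect_nonneg[OF l] \<omega> by simp
      moreover have "Re l > 0"
        using assms(3) False Re_mode_root_pos[of "Complex \<eta> \<xi>"] by (simp add: l_def)
      ultimately show False by simp
    qed
  qed
qed

lemma KL: "KL_condition M R F"
  unfolding KL_condition_def
proof (intro allI impI)
  fix \<eta> \<xi> w2 w3 :: real assume "\<eta> > 0"
  moreover from this have "0 < \<eta>\<^sup>2 + \<xi>\<^sup>2 + (w2\<^sup>2 + w3\<^sup>2)" by (intro add_pos_nonneg) simp_all
  ultimately show "det (lopatinski_matrix M R F \<eta> \<xi> w2 w3) \<noteq> 0"
    by (intro det_lopatinski_nonzero) simp_all
qed

section \<open>Zeros on the boundary Re s = 0\<close>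

definition phase :: "real \<Rightarrow> real \<Rightarrow> real \<Rightarrow> real" where
  "phase \<xi> w2 w3 = M * Mstar F * \<xi> - M * tang_inner F w2 w3 / Mstar F"

lemma freq_imaginary: "freq (Complex 0 \<xi>) w2 w3 = \<i> * complex_of_real (phase \<xi> w2 w3)"
  by (simp add: freq_def phase_def complex_eq_iff)

lemma drift_imaginary:
  "drift (Complex 0 \<xi>) w2 w3
     = \<i> * complex_of_real (M / Mstar F * phase \<xi> w2 w3 - (beta M F)\<^sup>2 * tang_inner F w2 w3 / (Mstar F)\<^sup>2)"
proof -
  have "M\<^sup>2 * \<xi> - tang_inner F w2 w3
      = M / Mstar F * phase \<xi> w2 w3 - (beta M F)\<^sup>2 * tang_inner F w2 w3 / (Mstar F)\<^sup>2"
    unfolding phase_def beta_squared using Mstar_pos by (simp add: field_simps power2_eq_square)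
  moreover have "drift (Complex 0 \<xi>) w2 w3 = \<i> * complex_of_real (M\<^sup>2 * \<xi> - tang_inner F w2 w3)"
    by (simp add: drift_def complex_eq_iff flip: of_real_power)
  ultimately show ?thesis by simp
qed

lemma cutoff_nonneg: "0 \<le> cutoff w2 w3"
  using radical_nonneg beta_pos Mstar_pos by (simp add: cutoff_def)

text \<open>At a zero beta^2 l = i g with |g| = beta sqrt(|\<omega>|^2 K). Since |\<alpha>| >= P and
  the square root has the sign of \<alpha>, the two add up, and |g| is at least M P / Mstar minus
  the shift beta^2 |m| / Mstar^2. Multiplying by Mstar^2 / beta gives the claim.\<close>

lemma boundary_zero_necessary:
  assumes K: "defect \<ge> 0"
    and root: "complex_of_real ((beta M F)\<^sup>2) * (mode_root (Complex 0 \<xi>) w2 w3)\<^sup>2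
      = - complex_of_real ((w2\<^sup>2 + w3\<^sup>2) * defect)"
  shows "M * radical w2 w3 - \<bar>tang_inner F w2 w3\<bar> * beta M F
    \<le> (Mstar F)\<^sup>2 * sqrt ((w2\<^sup>2 + w3\<^sup>2) * defect)"
proof -
  define \<alpha> where "\<alpha> = phase \<xi> w2 w3"
  define P where "P = cutoff w2 w3"
  define m where "m = tang_inner F w2 w3"
  define l where "l = mode_root (Complex 0 \<xi>) w2 w3"
  define y where "y = M / Mstar F * \<alpha> - (beta M F)\<^sup>2 * m / (Mstar F)\<^sup>2"
  have bl: "complex_of_real ((beta M F)\<^sup>2) * l = \<i> * y + hsqrt (\<i> * \<alpha>) P"
    unfolding l_def beta_mode_root drift_imaginary freq_imaginary by (simp add: \<alpha>_def P_def m_def y_def)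
  have "Re l = 0"
    using imaginary_axis_of_defect_nonneg[OF root] K by (simp add: l_def)
  then have "Re (hsqrt (\<i> * \<alpha>) P) = 0"
    using arg_cong[OF bl, of Re] by simp
  \<comment> \<open>For |\<alpha>| < P the root would have positive real part.\<close>
  then have \<alpha>: "\<alpha> \<ge> P \<or> \<alpha> \<le> - P"
    using hsqrt_imaginary(3)[of P \<alpha>] cutoff_nonneg[of w2 w3] by (force simp: P_def)
  define z where "z = sqrt (\<alpha>\<^sup>2 - P\<^sup>2)"
  define g where "g = (if \<alpha> \<ge> P then y + z else y - z)"
  have "complex_of_real ((beta M F)\<^sup>2) * l = \<i> * g"
  proof (cases "\<alpha> \<ge> P")
    case True
    then have "hsqrt (\<i> * \<alpha>) P = \<i> * z"
      using hsqrt_imaginary(1)[of P \<alpha>] cutoff_nonneg[of w2 w3] by (simp add: P_def z_def)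
    then show ?thesis unfolding bl using True by (simp add: g_def distrib_left)
  next
    case False
    then have "hsqrt (\<i> * \<alpha>) P = - \<i> * z"
      using hsqrt_imaginary(2)[of P \<alpha>] cutoff_nonneg[of w2 w3] \<alpha> by (simp add: P_def z_def)
    then show ?thesis unfolding bl using False by (simp add: g_def right_diff_distrib)
  qed
  then have "(complex_of_real ((beta M F)\<^sup>2) * l)\<^sup>2 = - complex_of_real (g\<^sup>2)"
    by (simp add: power_mult_distrib)
  moreover have "(complex_of_real ((beta M F)\<^sup>2) * l)\<^sup>2
      = complex_of_real ((beta M F)\<^sup>2) * (complex_of_real ((beta M F)\<^sup>2) * l\<^sup>2)"
    by (simp add: power2_eq_square mult_ac)
  ultimately have "complex_of_real (g\<^sup>2) = complex_of_real ((beta M F)\<^sup>2 * ((w2\<^sup>2 + w3\<^sup>2) * defect))"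
    unfolding root[folded l_def] by simp
  then have "g\<^sup>2 = (beta M F)\<^sup>2 * ((w2\<^sup>2 + w3\<^sup>2) * defect)"
    by (simp only: of_real_eq_iff)
  then have g: "\<bar>g\<bar> = beta M F * sqrt ((w2\<^sup>2 + w3\<^sup>2) * defect)"
    using beta_pos by (metis real_sqrt_abs real_sqrt_mult abs_of_pos)
  have "P\<^sup>2 \<le> \<alpha>\<^sup>2" using \<alpha> cutoff_nonneg[of w2 w3]
    by (auto simp: P_def abs_le_square_iff[symmetric])
  then have z: "z \<ge> 0" by (simp add: z_def)
  have MP: "M / Mstar F * P \<le> M / Mstar F * \<bar>\<alpha>\<bar>"
    using \<alpha> M_pos Mstar_pos cutoff_nonneg[of w2 w3] by (intro mult_left_mono) (auto simp: P_def)
  define c where "c = (beta M F)\<^sup>2 * m / (Mstar F)\<^sup>2"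
  have "M / Mstar F * P \<le> \<bar>g\<bar> + \<bar>c\<bar>"
    using \<alpha> z MP cutoff_nonneg[of w2 w3] by (auto simp: g_def y_def c_def[symmetric] P_def[symmetric] abs_if split: if_splits)
  then have "(Mstar F)\<^sup>2 * (M / Mstar F * P) \<le> (Mstar F)\<^sup>2 * (\<bar>g\<bar> + \<bar>c\<bar>)"
    by (intro mult_left_mono) simp_all
  moreover have "(Mstar F)\<^sup>2 * (M / Mstar F * P) = beta M F * (M * radical w2 w3)"
    using Mstar_pos by (simp add: P_def cutoff_def power2_eq_square)
  moreover have "(Mstar F)\<^sup>2 * \<bar>c\<bar> = beta M F * (\<bar>m\<bar> * beta M F)"
    using Mstar_pos by (simp add: c_def abs_mult power2_eq_square)
  ultimately have "beta M F * (M * radical w2 w3)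
      \<le> beta M F * ((Mstar F)\<^sup>2 * sqrt ((w2\<^sup>2 + w3\<^sup>2) * defect) + \<bar>m\<bar> * beta M F)"
    unfolding g by (simp add: algebra_simps)
  then show ?thesis
    unfolding mult_le_cancel_left_pos[OF beta_pos] by (simp add: m_def)
qed

text \<open>The intermediate value theorem provides \<alpha> >= P at which the upper imaginary
  branch takes the required value.\<close>

lemma boundary_zero_sufficient:
  assumes K: "defect \<ge> 0" and m: "tang_inner F w2 w3 \<ge> 0"
    and le: "M * radical w2 w3 - tang_inner F w2 w3 * beta M F
      \<le> (Mstar F)\<^sup>2 * sqrt ((w2\<^sup>2 + w3\<^sup>2) * defect)"
  obtains \<xi> where "complex_of_real ((beta M F)\<^sup>2) * (mode_root (Complex 0 \<xi>) w2 w3)\<^sup>2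
      = - complex_of_real ((w2\<^sup>2 + w3\<^sup>2) * defect)"
proof -
  define P where "P = cutoff w2 w3"
  define c where "c = (beta M F)\<^sup>2 * tang_inner F w2 w3 / (Mstar F)\<^sup>2"
  define k where "k = sqrt ((w2\<^sup>2 + w3\<^sup>2) * defect)"
  \<comment> \<open>The value of \<open>h\<close> for which beta^2 l = i beta k, where
    \<open>c\<close> undoes the shift in the drift.\<close>
  define T where "T = beta M F * k + c"
  define \<mu> where "\<mu> = M / Mstar F"
  define h where "h \<alpha> = \<mu> * \<alpha> + sqrt (\<alpha>\<^sup>2 - P\<^sup>2)" for \<alpha>
  have \<mu>: "\<mu> > 0" using M_pos Mstar_pos by (simp add: \<mu>_def)
  have P: "P \<ge> 0" using cutoff_nonneg by (simp add: P_def)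
  have "beta M F * (M * radical w2 w3)
      \<le> beta M F * ((Mstar F)\<^sup>2 * k + tang_inner F w2 w3 * beta M F)"
    using le beta_pos by (intro mult_left_mono) (simp_all add: k_def)
  moreover have "(Mstar F)\<^sup>2 * (\<mu> * P) = beta M F * (M * radical w2 w3)"
    using Mstar_pos by (simp add: P_def cutoff_def \<mu>_def power2_eq_square)
  moreover have "(Mstar F)\<^sup>2 * T = beta M F * ((Mstar F)\<^sup>2 * k + tang_inner F w2 w3 * beta M F)"
    using Mstar_pos by (simp add: T_def c_def power2_eq_square algebra_simps)
  ultimately have "(Mstar F)\<^sup>2 * (\<mu> * P) \<le> (Mstar F)\<^sup>2 * T" by simp
  then have PT: "\<mu> * P \<le> T" using Mstar_pos by simp
  then have PT': "P \<le> T / \<mu>" using \<mu> by (simp add: pos_le_divide_eq mult.commute)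
  then have "P\<^sup>2 \<le> (T / \<mu>)\<^sup>2" using P by (intro power_mono)
  \<comment> \<open>At this right endpoint the linear part alone already equals T; at the left
    endpoint P the square root vanishes.\<close>
  then have "T \<le> h (T / \<mu>)" using \<mu> by (simp add: h_def)
  moreover have "h P \<le> T" using PT by (simp add: h_def)
  moreover have "continuous_on {P..T / \<mu>} h"
    unfolding h_def by (intro continuous_intros)
  ultimately obtain \<alpha> where \<alpha>: "P \<le> \<alpha>" "h \<alpha> = T"
    using IVT'[of h P T "T / \<mu>"] PT' by blast
  define \<xi> where "\<xi> = (\<alpha> + M * tang_inner F w2 w3 / Mstar F) / (M * Mstar F)"
  have ph: "phase \<xi> w2 w3 = \<alpha>"
    using M_pos Mstar_pos by (simp add: phase_def \<xi>_def)
  define l where "l = mode_root (Complex 0 \<xi>) w2 w3"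
  have "complex_of_real ((beta M F)\<^sup>2) * l = \<i> * complex_of_real (\<mu> * \<alpha> - c) + \<i> * sqrt (\<alpha>\<^sup>2 - P\<^sup>2)"
    using hsqrt_imaginary(1)[OF P \<alpha>(1)] unfolding l_def beta_mode_root drift_imaginary freq_imaginary ph
    by (simp add: P_def c_def \<mu>_def)
  also have "\<dots> = \<i> * complex_of_real (h \<alpha> - c)" by (simp add: h_def algebra_simps)
  also have "h \<alpha> - c = beta M F * k" by (simp add: \<alpha>(2) T_def)
  finally have "complex_of_real (beta M F) * (complex_of_real (beta M F) * l)
      = complex_of_real (beta M F) * (\<i> * complex_of_real k)"
    by (simp add: power2_eq_square mult_ac)
  then have "complex_of_real (beta M F) * l = \<i> * complex_of_real k"
    using beta_pos by simp
  then have "(complex_of_real (beta M F) * l)\<^sup>2 = - complex_of_real (k\<^sup>2)"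
    by (simp add: power_mult_distrib)
  then have "complex_of_real ((beta M F)\<^sup>2) * l\<^sup>2 = - complex_of_real (k\<^sup>2)"
    by (simp add: power_mult_distrib)
  also have "k\<^sup>2 = (w2\<^sup>2 + w3\<^sup>2) * defect" using K by (simp add: k_def)
  finally show ?thesis using that by (simp add: l_def)
qed

section \<open>Homogeneity and the criterion on the unit circle\<close>

lemma tang_scale: "tang F (c * w2) (c * w3) = c *\<^sub>R tang F w2 w3"
  by (simp add: tang_def scaleR_add_right)

lemma tang_inner_scale: "tang_inner F (c * w2) (c * w3) = c * tang_inner F w2 w3"
  by (simp add: tang_inner_def tang_scale)

lemma radical_scale: "radical (c * w2) (c * w3) = \<bar>c\<bar> * radical w2 w3"
proof -
  have "(Mstar F)\<^sup>2 * ((norm (tang F (c * w2) (c * w3)))\<^sup>2 + ((c * w2)\<^sup>2 + (c * w3)\<^sup>2)) - (tang_inner F (c * w2) (c * w3))\<^sup>2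
     = c\<^sup>2 * ((Mstar F)\<^sup>2 * ((norm (tang F w2 w3))\<^sup>2 + (w2\<^sup>2 + w3\<^sup>2)) - (tang_inner F w2 w3)\<^sup>2)"
    by (simp add: tang_scale tang_inner_scale power_mult_distrib algebra_simps)
  then show ?thesis by (simp add: radical_def real_sqrt_mult)
qed

text \<open>Lagrange's identity turns |F_1 x W|^2 into M1^2 |W|^2 - m^2, and the summand 1 + M1^2 is
  Mstar^2 |\<omega>|^2 on the unit circle.\<close>

lemma criterion_term_eq:
  assumes "w2\<^sup>2 + w3\<^sup>2 = 1"
  shows "criterion_term M F (w2, w3) = (M * radical w2 w3 - \<bar>tang_inner F w2 w3\<bar> * beta M F)\<^sup>2"
proof -
  have "1 + (norm (F $ 1))\<^sup>2 + (norm (tang F w2 w3))\<^sup>2 + (norm (F $ 1 \<times> tang F w2 w3))\<^sup>2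
      = (Mstar F)\<^sup>2 * ((norm (tang F w2 w3))\<^sup>2 + (w2\<^sup>2 + w3\<^sup>2)) - (tang_inner F w2 w3)\<^sup>2"
    using norm_cross_dot[of "F $ 1" "tang F w2 w3"] unfolding assms Mstar_squared
    by (simp add: M1_def tang_inner_def algebra_simps power_mult_distrib)
  moreover have "sqrt (1 + (norm (F $ 1))\<^sup>2 - M\<^sup>2) = beta M F"
    by (simp add: beta_def Mstar_squared M1_def)
  ultimately show ?thesis
    unfolding criterion_term_def Let_def prod.case tang_def[symmetric] radical_def tang_inner_def[symmetric]
    by (simp only:)
qed

text \<open>Because the infimum is attained, positivity of the margin is a strict inequality in
  every direction.\<close>

lemma stability_margin_pos_iff:
  "stability_margin M R F > 0 \<longleftrightarrow>
     (\<forall>w2 w3. w2\<^sup>2 + w3\<^sup>2 = 1 \<longrightarrow> (M * radical w2 w3 - \<bar>tang_inner F w2 w3\<bar> * beta M F)\<^sup>2 > ((Mstar F)\<^sup>2)\<^sup>2 * defect)"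
proof -
  define S where "S = {(w2, w3). w2\<^sup>2 + w3\<^sup>2 = (1::real)}"
  obtain w0 where w0: "w0 \<in> S" "(INF w\<in>S. criterion_term M F w) = criterion_term M F w0"
    using criterion_term_min_attained unfolding S_def by blast
  have "bdd_below (criterion_term M F ` S)"
    by (rule bdd_belowI2[where m = 0]) (auto simp: criterion_term_def Let_def)
  then have low: "criterion_term M F w0 \<le> criterion_term M F w" if "w \<in> S" for w
    unfolding w0(2)[symmetric] using that by (rule cINF_lower)
  have "stability_margin M R F = criterion_term M F w0 - ((Mstar F)\<^sup>2)\<^sup>2 * defect"
    unfolding stability_margin_def S_def[symmetric] w0(2) by (simp add: Mstar_squared defect_def M1_def)
  then have "stability_margin M R F > 0 \<longleftrightarrow> (\<forall>w\<in>S. criterion_term M F w > ((Mstar F)\<^sup>2)\<^sup>2 * defect)"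
    using w0(1) low by force
  then show ?thesis by (auto simp: S_def criterion_term_eq)
qed

text \<open>For K < 0 both sides hold. For K >= 0 only boundary zeros matter, and the two boundary
  lemmas match them with failure of the criterion after square roots are taken.\<close>

lemma UKL_iff: "UKL_condition M R F \<longleftrightarrow> stability_margin M R F > 0"
proof (cases "defect < 0")
  case True
  then have "((Mstar F)\<^sup>2)\<^sup>2 * defect < 0"
    using Mstar_pos by (simp add: mult_pos_neg)
  then have "stability_margin M R F > 0"
    unfolding stability_margin_pos_iff by (metis less_le_trans zero_le_power2)
  moreover have "UKL_condition M R F"
    unfolding UKL_condition_def using True det_lopatinski_nonzero by blast
  ultimately show ?thesis by simp
next
  case False
  then have K: "defect \<ge> 0" by simp
  define d where "d w2 w3 = M * radical w2 w3 - \<bar>tang_inner F w2 w3\<bar> * beta M F" for w2 w3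
  have iff: "((Mstar F)\<^sup>2)\<^sup>2 * defect < (d w2 w3)\<^sup>2 \<longleftrightarrow> (Mstar F)\<^sup>2 * sqrt defect < d w2 w3"
    if "w2\<^sup>2 + w3\<^sup>2 = 1" for w2 w3
  proof -
    have "d w2 w3 > 0" using tang_inner_beta_less[of w2 w3] that by (simp add: d_def)
    moreover have "((Mstar F)\<^sup>2)\<^sup>2 * defect = ((Mstar F)\<^sup>2 * sqrt defect)\<^sup>2"
      using K by (simp add: power_mult_distrib)
    moreover have "0 \<le> (Mstar F)\<^sup>2 * sqrt defect" using K by simp
    ultimately show ?thesis by (metis less_imp_le not_le pos2 power_mono_iff)
  qed
  have margin: "stability_margin M R F > 0 \<longleftrightarrow>
      (\<forall>w2 w3. w2\<^sup>2 + w3\<^sup>2 = 1 \<longrightarrow> (Mstar F)\<^sup>2 * sqrt defect < d w2 w3)"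
    unfolding stability_margin_pos_iff d_def[symmetric] using iff by blast
  show ?thesis
  proof
    assume U: "UKL_condition M R F"
    show "stability_margin M R F > 0"
    proof (rule ccontr)
      assume "\<not> stability_margin M R F > 0"
      then obtain w2 w3 where w: "w2\<^sup>2 + w3\<^sup>2 = 1" "d w2 w3 \<le> (Mstar F)\<^sup>2 * sqrt defect"
        unfolding margin by (auto simp: not_less)
      \<comment> \<open>Reversing the tangential frequency if necessary makes m nonnegative and
        preserves \<open>radical\<close>.\<close>
      define \<epsilon> where "\<epsilon> = (if tang_inner F w2 w3 \<ge> 0 then 1 else -1 :: real)"
      have c: "tang_inner F (\<epsilon> * w2) (\<epsilon> * w3) = \<bar>tang_inner F w2 w3\<bar>"
        unfolding tang_inner_scale by (simp add: \<epsilon>_def)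
      have r: "radical (\<epsilon> * w2) (\<epsilon> * w3) = radical w2 w3"
        unfolding radical_scale by (simp add: \<epsilon>_def)
      have w': "(\<epsilon> * w2)\<^sup>2 + (\<epsilon> * w3)\<^sup>2 = 1"
        using w(1) by (simp add: power_mult_distrib \<epsilon>_def)
      obtain \<xi> where "complex_of_real ((beta M F)\<^sup>2) * (mode_root (Complex 0 \<xi>) (\<epsilon> * w2) (\<epsilon> * w3))\<^sup>2
          = - complex_of_real (((\<epsilon> * w2)\<^sup>2 + (\<epsilon> * w3)\<^sup>2) * defect)"
        using boundary_zero_sufficient[OF K, of "\<epsilon> * w2" "\<epsilon> * w3"] w(2)
        unfolding c r w' d_def by auto
      moreover have "(0::real)\<^sup>2 + \<xi>\<^sup>2 + ((\<epsilon> * w2)\<^sup>2 + (\<epsilon> * w3)\<^sup>2) \<noteq> 0"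
        unfolding w' by (smt (verit) zero_le_power2)
      ultimately have "det (lopatinski_matrix M R F 0 \<xi> (\<epsilon> * w2) (\<epsilon> * w3)) = 0"
        by (subst det_lopatinski_eq_0_iff) simp_all
      then show False
        using U \<open>0\<^sup>2 + \<xi>\<^sup>2 + ((\<epsilon> * w2)\<^sup>2 + (\<epsilon> * w3)\<^sup>2) \<noteq> 0\<close> unfolding UKL_condition_def by blast
    qed
  next
    assume pos: "stability_margin M R F > 0"
    show "UKL_condition M R F"
      unfolding UKL_condition_def
    proof (intro allI impI, elim conjE)
      fix \<eta> \<xi> w2 w3 :: real
      assume \<eta>: "0 \<le> \<eta>" and nz: "\<eta>\<^sup>2 + \<xi>\<^sup>2 + (w2\<^sup>2 + w3\<^sup>2) \<noteq> 0"
      show "det (lopatinski_matrix M R F \<eta> \<xi> w2 w3) \<noteq> 0"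
      proof (cases "\<eta> > 0 \<or> w2\<^sup>2 + w3\<^sup>2 = 0")
        case True
        then show ?thesis
          using det_lopatinski_nonzero[OF \<eta> nz] det_lopatinski_nonzero_tangential[OF \<eta> nz] by blast
      next
        case False
        then have \<eta>0: "\<eta> = 0" and "w2\<^sup>2 + w3\<^sup>2 > 0" using \<eta> by (auto simp: order_less_le)
        \<comment> \<open>Both sides of the inequality are homogeneous of degree one, so the
          criterion is applied to the normalised frequency.\<close>
        define \<rho> where "\<rho> = sqrt (w2\<^sup>2 + w3\<^sup>2)"
        have \<rho>: "\<rho> > 0" "\<rho>\<^sup>2 = w2\<^sup>2 + w3\<^sup>2" using \<open>w2\<^sup>2 + w3\<^sup>2 > 0\<close> by (simp_all add: \<rho>_def)
        have sc: "w2 = \<rho> * (w2 / \<rho>)" "w3 = \<rho> * (w3 / \<rho>)" using \<rho> by simp_all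
        have "(w2 / \<rho>)\<^sup>2 + (w3 / \<rho>)\<^sup>2 = 1"
          unfolding power_divide add_divide_distrib[symmetric] \<rho>(2)[symmetric] using \<rho>(1) by simp
        with pos have "(Mstar F)\<^sup>2 * sqrt defect < d (w2 / \<rho>) (w3 / \<rho>)"
          unfolding margin by blast
        then have "\<rho> * ((Mstar F)\<^sup>2 * sqrt defect) < \<rho> * d (w2 / \<rho>) (w3 / \<rho>)"
          using \<rho> by simp
        also have "\<rho> * d (w2 / \<rho>) (w3 / \<rho>) = d w2 w3"
          unfolding d_def using radical_scale[of \<rho> "w2 / \<rho>" "w3 / \<rho>"] tang_inner_scale[of \<rho> "w2 / \<rho>" "w3 / \<rho>"] \<rho>(1)
          by (simp add: algebra_simps abs_mult flip: sc)
        finally have "(Mstar F)\<^sup>2 * sqrt ((w2\<^sup>2 + w3\<^sup>2) * defect) < d w2 w3"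
          by (simp add: real_sqrt_mult \<rho>_def mult_ac)
        then show ?thesis
          using boundary_zero_necessary[OF K, of \<xi> w2 w3] nz
          unfolding \<eta>0 by (subst det_lopatinski_eq_0_iff) (auto simp: d_def)
      qed
    qed
  qed
qed

end

theorem theorem4p1:
  fixes p :: "real \<Rightarrow> real" and Um Up :: elastic_state
    and M M_minus R :: real and F :: "real^3^3"
  assumes "planar_shock p Um Up"
    and "M_minus = mach p Um" and "M = mach p Up"
    and "R = density_ratio Um Up" and "F = scaled_defgrad p Up"
    and "M_minus > M / sqrt (M\<^sup>2 - (M1 F)\<^sup>2)"
    and "M1 F < M" and "M < Mstar F"
  shows "(uniformly_stable p Um Up \<longleftrightarrow> stability_margin M R F > 0) \<and>
         (\<not> stability_margin M R F > 0 \<longrightarrow> weakly_stable p Um Up)"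
proof -
  have "R > 0"
    using assms(1) by (simp add: assms(4) planar_shock_def admissible_state_def density_ratio_def)
  then interpret lax_shock M R F
    using assms(7,8) by unfold_locales
  \<comment> \<open>Since \<open>KL\<close> excludes violent instability, failure of the uniform
    condition is weak stability.\<close>
  show ?thesis
    unfolding uniformly_stable_def weakly_stable_def assms(3,4,5)[symmetric]
    using UKL_iff KL by blast
qed

end
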